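(* For the prediction step based on the kinetic description and on the hydrostatic reconstruction given in the context, there exist constants $v_m$ and $C_\beta$ such that, for $\sigma_i$ small enough, the fully discrete entropy inequality $$\tilde\eta(X_i^{n+1/2})\le\tilde\eta(X_i)-\sigma_i\bigl(\widetilde G_{i+1/2}-\widetilde G_{i-1/2}\bigr)+C_\beta(\sigma_iv_m)^2\Bigl(g(z_{b,i+1}-z_{b,i})^2+g(z_{b,i}-z_{b,i-1})^2\Bigr)$$ holds, with $\widetilde G_{i+1/2}=\widetilde G_{hyd,i+1/2}+F_{H,i+1/2}\dfrac{w_{i+1/2}^2}2$ and $$\widetilde G_{hyd,i+1/2}=\int_{\xi<0}\xi\,H_K(M_{i+1/2+},\xi,z_{b,i+1/2})\,d\xi+\int_{\xi>0}\xi\,H_K(M_{i+1/2-},\xi,z_{b,i+1/2})\,d\xi .$$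
   Context: $g>0$; $\sigma_i=\Delta t/\Delta x_i$ with $\Delta x_i$ the length of cell $i$ and $\Delta t$ the time step. The data at time $t^n$ (superscript $n$ dropped) are $X_i=(H_i,H_iu_i,H_iw_i)^T$ with $H_i\ge0$, and topography values $z_{b,i}$. The entropy is $$\tilde\eta(X_i)=\frac{H_i}2(u_i^2+w_i^2)+\frac g2H_i^2+gH_iz_{b,i}.$$ Maxwellian: $M(H,u,\xi)=\frac1{g\pi}\bigl(2gH-(\xi-u)^2\bigr)_+^{1/2}$, $\xi\in\mathbb R$, $a_+=\max(a,0)$. Kinetic entropy: $H_K(f,\xi,z)=\frac{\xi^2}2f+\frac{g^2\pi^2}6f^3+gzf$ for $f\ge0$. Hydrostatic reconstruction: $z_{b,i+1/2}=\max(z_{b,i},z_{b,i+1})$, $H_{i+1/2-}=(H_i+z_{b,i}-z_{b,i+1/2})_+$, $H_{i+1/2+}=(H_{i+1}+z_{b,i+1}-z_{b,i+1/2})_+$. Put $M_i=M(H_i,u_i,\xi)$, $M_{i+1/2-}=M(H_{i+1/2-},u_i,\xi)$, $M_{i+1/2+}=M(H_{i+1/2+},u_{i+1},\xi)$, $\delta M_{i+1/2-}=(\xi-u_i)(M_i-M_{i+1/2-})$, $\delta M_{i+1/2+}=(\xi-u_{i+1})(M_{i+1}-M_{i+1/2+})$, and $$f_i^{n+1/2-}=M_i-\sigma_i\Bigl(\xi\mathbf 1_{\xi<0}M_{i+1/2+}+\xi\mathbf 1_{\xi>0}M_{i+1/2-}+\delta M_{i+1/2-}-\xi\mathbf 1_{\xi>0}M_{i-1/2-}-\xi\mathbf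 1_{\xi<0}M_{i-1/2+}-\delta M_{i-1/2+}\Bigr).$$ The prediction step defines $X_i^{n+1/2}=(H_i^{n+1/2},(Hu)_i^{n+1/2},(Hw)_i^{n+1/2})^T$ by $$\begin{pmatrix}H\\ Hu\end{pmatrix}_i^{n+1/2}=\int_{\mathbb R}\begin{pmatrix}1\\ \xi\end{pmatrix}f_i^{n+1/2-}(\xi)\,d\xi,\qquad (Hw)_i^{n+1/2}=H_iw_i-\sigma_i\bigl(w_{i+1/2}F_{H,i+1/2}-w_{i-1/2}F_{H,i-1/2}\bigr),$$ where $$F_{H,i+1/2}=\int_{\mathbb R}\xi\bigl(\mathbf 1_{\xi>0}M_{i+1/2-}+\mathbf 1_{\xi<0}M_{i+1/2+}\bigr)\,d\xi,\qquad w_{i+1/2}=\begin{cases}w_i&\text{if }F_{H,i+1/2}\ge0,\\ w_{i+1}&\text{if }F_{H,i+1/2}<0.\end{cases}$$ The constants $v_m,C_\beta$ do not depend on $\sigma_i$. *)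

theory Defs
  imports "HOL-Analysis.Analysis"
begin

text \<open>
  Cells are indexed by \<open>int\<close>. A quantity attached to the interface \<open>i + 1/2\<close> is given the
  index \<open>i\<close>, so that the same quantity at \<open>i - 1/2\<close> has index \<open>i - 1\<close>.
\<close>

definition cell_ratio :: "real \<Rightarrow> (int \<Rightarrow> real) \<Rightarrow> int \<Rightarrow> real" where
  "cell_ratio dt dx i = dt / dx i"

text \<open>
  The entropy is a function of the conserved state \<open>(h, hu, hw)\<close>, the velocities being
  \<open>hu / h\<close> and \<open>hw / h\<close>. By the convention \<open>x / 0 = 0\<close> a dry state (\<open>h = 0\<close>) has entropy 0.
\<close>

definition entropy :: "real \<Rightarrow> real \<Rightarrow> real \<times> real \<times> real \<Rightarrow> real" where
  "entropy g zb X = (case X of (h, hu, hw) \<Rightarrow>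
     h / 2 * ((hu / h)\<^sup>2 + (hw / h)\<^sup>2) + g / 2 * h\<^sup>2 + g * h * zb)"

definition state :: "(int \<Rightarrow> real) \<Rightarrow> (int \<Rightarrow> real) \<Rightarrow> (int \<Rightarrow> real) \<Rightarrow> int \<Rightarrow> real \<times> real \<times> real" where
  "state H u w i = (H i, H i * u i, H i * w i)"

definition maxwellian :: "real \<Rightarrow> real \<Rightarrow> real \<Rightarrow> real \<Rightarrow> real" where
  "maxwellian g h v \<xi> = 1 / (g * pi) * sqrt (max (2 * g * h - (\<xi> - v)\<^sup>2) 0)"

definition kinetic_entropy :: "real \<Rightarrow> real \<Rightarrow> real \<Rightarrow> real \<Rightarrow> real" where
  "kinetic_entropy g f \<xi> z = \<xi>\<^sup>2 / 2 * f + g\<^sup>2 * pi\<^sup>2 / 6 * f ^ 3 + g * z * f"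


subsection \<open>Hydrostatic reconstruction\<close>

definition z_half :: "(int \<Rightarrow> real) \<Rightarrow> int \<Rightarrow> real" where
  "z_half zb i = max (zb i) (zb (i + 1))"

definition H_minus :: "(int \<Rightarrow> real) \<Rightarrow> (int \<Rightarrow> real) \<Rightarrow> int \<Rightarrow> real" where
  "H_minus H zb i = max (H i + zb i - z_half zb i) 0"

definition H_plus :: "(int \<Rightarrow> real) \<Rightarrow> (int \<Rightarrow> real) \<Rightarrow> int \<Rightarrow> real" where
  "H_plus H zb i = max (H (i + 1) + zb (i + 1) - z_half zb i) 0"


subsection \<open>Maxwellians of the cells and of the reconstructed states\<close>

definition M_cell ::
  "real \<Rightarrow> (int \<Rightarrow> real) \<Rightarrow> (int \<Rightarrow> real) \<Rightarrow> int \<Rightarrow> real \<Rightarrow> real" where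
  "M_cell g H u i \<xi> = maxwellian g (H i) (u i) \<xi>"

definition M_minus ::
  "real \<Rightarrow> (int \<Rightarrow> real) \<Rightarrow> (int \<Rightarrow> real) \<Rightarrow> (int \<Rightarrow> real) \<Rightarrow> int \<Rightarrow> real \<Rightarrow> real" where
  "M_minus g H u zb i \<xi> = maxwellian g (H_minus H zb i) (u i) \<xi>"

definition M_plus ::
  "real \<Rightarrow> (int \<Rightarrow> real) \<Rightarrow> (int \<Rightarrow> real) \<Rightarrow> (int \<Rightarrow> real) \<Rightarrow> int \<Rightarrow> real \<Rightarrow> real" where
  "M_plus g H u zb i \<xi> = maxwellian g (H_plus H zb i) (u (i + 1)) \<xi>"

definition dM_minus ::
  "real \<Rightarrow> (int \<Rightarrow> real) \<Rightarrow> (int \<Rightarrow> real) \<Rightarrow> (int \<Rightarrow> real) \<Rightarrow> int \<Rightarrow> real \<Rightarrow> real" where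
  "dM_minus g H u zb i \<xi> = (\<xi> - u i) * (M_cell g H u i \<xi> - M_minus g H u zb i \<xi>)"

definition dM_plus ::
  "real \<Rightarrow> (int \<Rightarrow> real) \<Rightarrow> (int \<Rightarrow> real) \<Rightarrow> (int \<Rightarrow> real) \<Rightarrow> int \<Rightarrow> real \<Rightarrow> real" where
  "dM_plus g H u zb i \<xi> =
     (\<xi> - u (i + 1)) * (M_cell g H u (i + 1) \<xi> - M_plus g H u zb i \<xi>)"


subsection \<open>Prediction step\<close>

definition f_pred ::
  "real \<Rightarrow> real \<Rightarrow> (int \<Rightarrow> real) \<Rightarrow> (int \<Rightarrow> real) \<Rightarrow> (int \<Rightarrow> real) \<Rightarrow> int \<Rightarrow> real \<Rightarrow> real" where
  "f_pred g \<sigma> H u zb i \<xi> = M_cell g H u i \<xi> - \<sigma> *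
     ( \<xi> * indicator {..<0} \<xi> * M_plus g H u zb i \<xi>
     + \<xi> * indicator {0<..} \<xi> * M_minus g H u zb i \<xi>
     + dM_minus g H u zb i \<xi>
     - \<xi> * indicator {0<..} \<xi> * M_minus g H u zb (i - 1) \<xi>
     - \<xi> * indicator {..<0} \<xi> * M_plus g H u zb (i - 1) \<xi>
     - dM_plus g H u zb (i - 1) \<xi>)"

definition F_H ::
  "real \<Rightarrow> (int \<Rightarrow> real) \<Rightarrow> (int \<Rightarrow> real) \<Rightarrow> (int \<Rightarrow> real) \<Rightarrow> int \<Rightarrow> real" where
  "F_H g H u zb i =
     (LBINT \<xi>. \<xi> * (indicator {0<..} \<xi> * M_minus g H u zb i \<xi>
                 + indicator {..<0} \<xi> * M_plus g H u zb i \<xi>))"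

definition w_half ::
  "real \<Rightarrow> (int \<Rightarrow> real) \<Rightarrow> (int \<Rightarrow> real) \<Rightarrow> (int \<Rightarrow> real) \<Rightarrow> (int \<Rightarrow> real) \<Rightarrow> int \<Rightarrow> real" where
  "w_half g H u w zb i = (if F_H g H u zb i \<ge> 0 then w i else w (i + 1))"

definition predicted_state ::
  "real \<Rightarrow> real \<Rightarrow> (int \<Rightarrow> real) \<Rightarrow> (int \<Rightarrow> real) \<Rightarrow> (int \<Rightarrow> real) \<Rightarrow> (int \<Rightarrow> real) \<Rightarrow> int
     \<Rightarrow> real \<times> real \<times> real" where
  "predicted_state g \<sigma> H u w zb i =
     ( LBINT \<xi>. f_pred g \<sigma> H u zb i \<xi>,
       LBINT \<xi>. \<xi> * f_pred g \<sigma> H u zb i \<xi>,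
       H i * w i - \<sigma> * (w_half g H u w zb i * F_H g H u zb i
                       - w_half g H u w zb (i - 1) * F_H g H u zb (i - 1)))"


subsection \<open>Entropy fluxes\<close>

definition G_hyd ::
  "real \<Rightarrow> (int \<Rightarrow> real) \<Rightarrow> (int \<Rightarrow> real) \<Rightarrow> (int \<Rightarrow> real) \<Rightarrow> int \<Rightarrow> real" where
  "G_hyd g H u zb i =
     (LBINT \<xi>:{..<0}. \<xi> * kinetic_entropy g (M_plus g H u zb i \<xi>) \<xi> (z_half zb i))
   + (LBINT \<xi>:{0<..}. \<xi> * kinetic_entropy g (M_minus g H u zb i \<xi>) \<xi> (z_half zb i))"

definition G_tilde ::
  "real \<Rightarrow> (int \<Rightarrow> real) \<Rightarrow> (int \<Rightarrow> real) \<Rightarrow> (int \<Rightarrow> real) \<Rightarrow> (int \<Rightarrow> real) \<Rightarrow> int \<Rightarrow> real" where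
  "G_tilde g H u w zb i =
     G_hyd g H u zb i + F_H g H u zb i * ((w_half g H u w zb i)\<^sup>2 / 2)"

end

theory Submission
  imports Defs
begin

text \<open>
  The prediction step replaces the Maxwellian \<open>M\<close> of a cell by a nonnegative density \<open>f\<close>, obtained
  from one explicit upwind step of a kinetic equation. Among the nonnegative densities of given mass and
  momentum the kinetic entropy is smallest at the Maxwellian (\<open>maxwellian_minimises_entropy\<close>), so
  the hydrostatic entropy of the new state is at most the integral of the kinetic entropy of \<open>f\<close>, and
  it suffices to bound the latter for each \<open>\<xi>\<close>.

  The kinetic entropy is a convex cubic in the density, hence equal to its tangent at \<open>M\<close> plus an
  explicit remainder. On the support of \<open>M\<close> the tangent has slope \<open>T\<close>, the gradient of the
  macroscopic entropy paired with \<open>(1, \<xi>)\<close>. Since the reconstruction preserves the free surface,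
  or else dries out below a bottom that is higher, \<open>T\<close> is also a subtangent at the reconstructed Maxwellians \<open>L\<close> and \<open>R\<close> for the raised bottoms
  (\<open>entropy_slope_reconstructed\<close>). For positive \<open>\<xi>\<close> one has
  \<open>f - M = \<sigma> \<xi> (N - L) - \<sigma> v (R - L)\<close>, with \<open>N\<close> the density coming from the left, and convexity
  bounds \<open>T (N - L)\<close> by a difference of kinetic entropies minus a dissipation of the size of
  \<open>(2 L + N) (N - L)\<^sup>2\<close>. Negative \<open>\<xi>\<close> is the mirror image. The terms that are left over,
  \<open>\<xi> H(R) - v T R\<close> and the same with \<open>L\<close>, integrate to zero (\<open>integral_entropy_flux_balance\<close>).

  The explicit remainder \<open>(2 M + f) (f - M)\<^sup>2\<close> has the wrong sign, but it is quadratic in the time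
  step. Its part due to \<open>N - L\<close> is absorbed by the dissipation, which is linear in the time step; the
  rest is at most a constant times \<open>(\<sigma> V)\<^sup>2 M ((M - L)\<^sup>2 + (M - R)\<^sup>2)\<close> (\<open>upwind_remainder\<close>).
  The integral of this is controlled by the squared losses of depth in the reconstruction
  (\<open>integral_maxwellian_distance\<close>), and these by the jumps of the topography.

  The transverse momentum is transported by the mass flux with an upwind velocity, so the new
  transverse velocity is a convex combination of old ones (\<open>transverse_entropy\<close>).
\<close>

section \<open>Continuous functions with compact support\<close>

text \<open>
  The functions of \<open>\<xi>\<close> below are built from Maxwellians by products with continuous functions
  (\<open>\<xi>\<close> restricted to a half line is the continuous function \<open>max \<xi> 0\<close> or \<open>min \<xi> 0\<close>), so
  this class contains them all and makes every integral in the proof converge.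
\<close>
definition cont_csupp :: "(real \<Rightarrow> real) \<Rightarrow> bool" where
  "cont_csupp f \<longleftrightarrow> continuous_on UNIV f \<and> (\<exists>R. \<forall>x. \<bar>x\<bar> > R \<longrightarrow> f x = 0)"

lemma cont_csupp_integrable:
  assumes "cont_csupp f"
  shows "integrable lborel f"
proof -
  obtain R where R: "\<And>x. \<bar>x\<bar> > R \<Longrightarrow> f x = 0" and c: "continuous_on UNIV f"
    using assms unfolding cont_csupp_def by blast
  have "integrable lborel (\<lambda>x. indicator {-R..R} x *\<^sub>R f x)"
    by (rule borel_integrable_compact) (auto intro: continuous_on_subset[OF c])
  moreover have "(\<lambda>x. indicator {-R..R} x *\<^sub>R f x) = f"
    using R by (force simp: indicator_def fun_eq_iff)
  ultimately show ?thesis by (simp only:)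
qed

lemma cont_csupp_add:
  assumes "cont_csupp f" "cont_csupp h"
  shows "cont_csupp (\<lambda>x. f x + h x)"
proof -
  obtain R S where "\<And>x. \<bar>x\<bar> > R \<Longrightarrow> f x = 0" "\<And>x. \<bar>x\<bar> > S \<Longrightarrow> h x = 0"
    using assms unfolding cont_csupp_def by blast
  then have "\<forall>x. \<bar>x\<bar> > max R S \<longrightarrow> f x + h x = 0" by auto
  then show ?thesis
    using assms unfolding cont_csupp_def by (blast intro: continuous_on_add)
qed

lemma cont_csupp_mult:
  assumes "continuous_on UNIV k" "cont_csupp f"
  shows "cont_csupp (\<lambda>x. k x * f x)"
proof -
  obtain R where "\<And>x. \<bar>x\<bar> > R \<Longrightarrow> f x = 0"
    using assms unfolding cont_csupp_def by blast
  then have "\<bar>x\<bar> > R \<longrightarrow> k x * f x = 0" for x by auto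
  then show ?thesis
    using assms unfolding cont_csupp_def by (auto intro!: continuous_intros)
qed

lemma cont_csupp_cmult: "cont_csupp f \<Longrightarrow> cont_csupp (\<lambda>x. k * f x)"
  by (rule cont_csupp_mult) auto

lemma cont_csupp_diff:
  assumes "cont_csupp f" "cont_csupp h"
  shows "cont_csupp (\<lambda>x. f x - h x)"
  using cont_csupp_add[OF assms(1) cont_csupp_cmult[OF assms(2), of "-1"]] by simp

lemma cont_csupp_continuous: "cont_csupp f \<Longrightarrow> continuous_on UNIV f"
  by (simp add: cont_csupp_def)

lemmas cont_csupp_intros = cont_csupp_add cont_csupp_diff cont_csupp_mult cont_csupp_cmult

lemma cont_csupp_kinetic_entropy:
  assumes "cont_csupp f"
  shows "cont_csupp (\<lambda>\<xi>. kinetic_entropy g (f \<xi>) \<xi> z)"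
proof -
  have "cont_csupp (\<lambda>\<xi>. (\<xi>\<^sup>2 / 2 + g\<^sup>2 * pi\<^sup>2 / 6 * (f \<xi>)\<^sup>2 + g * z) * f \<xi>)"
    by (intro cont_csupp_mult assms continuous_intros cont_csupp_continuous[OF assms]) auto
  moreover have "kinetic_entropy g (f \<xi>) \<xi> z
      = (\<xi>\<^sup>2 / 2 + g\<^sup>2 * pi\<^sup>2 / 6 * (f \<xi>)\<^sup>2 + g * z) * f \<xi>" for \<xi>
    by (simp add: kinetic_entropy_def algebra_simps power3_eq_cube power2_eq_square)
  ultimately show ?thesis by simp
qed

section \<open>Maxwellians and their moments\<close>

lemma maxwellian_nonneg: "g > 0 \<Longrightarrow> maxwellian g h v \<xi> \<ge> 0"
  by (simp add: maxwellian_def)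

lemma maxwellian_mono:
  "g > 0 \<Longrightarrow> h \<le> h' \<Longrightarrow> maxwellian g h v \<xi> \<le> maxwellian g h' v \<xi>"
  unfolding maxwellian_def
  by (intro mult_left_mono real_sqrt_le_mono max.mono diff_mono) auto

lemma maxwellian_square:
  assumes "g > 0"
  shows "g\<^sup>2 * pi\<^sup>2 * (maxwellian g h v \<xi>)\<^sup>2 = max (2 * g * h - (\<xi> - v)\<^sup>2) 0"
  using assms by (simp add: maxwellian_def power_mult_distrib power_divide)

lemma maxwellian_pos_imp:
  assumes "g > 0" "maxwellian g h v \<xi> > 0"
  shows "(\<xi> - v)\<^sup>2 < 2 * g * h"
  using assms by (auto simp: maxwellian_def max_def zero_less_mult_iff split: if_splits)

lemma maxwellian_support:
  assumes "g > 0" "\<bar>\<xi>\<bar> > \<bar>v\<bar> + sqrt (2 * g * h)" "h \<ge> 0"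
  shows "maxwellian g h v \<xi> = 0"
proof (rule ccontr)
  assume "maxwellian g h v \<xi> \<noteq> 0"
  then have "(\<xi> - v)\<^sup>2 < 2 * g * h"
    using maxwellian_pos_imp[of g h v \<xi>] maxwellian_nonneg[of g h v \<xi>] assms(1) by linarith
  then have "\<bar>\<xi> - v\<bar> < sqrt (2 * g * h)" by (rule real_less_rsqrt[of "\<bar>\<xi> - v\<bar>", simplified])
  with assms(2) show False by linarith
qed

lemma maxwellian_dry: "g > 0 \<Longrightarrow> maxwellian g 0 v \<xi> = 0"
  by (simp add: maxwellian_def max_def)

lemma cont_csupp_maxwellian:
  assumes "g > 0" "h \<ge> 0"
  shows "cont_csupp (maxwellian g h v)"
  unfolding cont_csupp_def
proof
  show "continuous_on UNIV (maxwellian g h v)"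
    unfolding maxwellian_def by (intro continuous_intros)
  show "\<exists>R. \<forall>x. R < \<bar>x\<bar> \<longrightarrow> maxwellian g h v x = 0"
    using maxwellian_support[OF assms(1) _ assms(2)] by blast
qed

text \<open>
  Up to the factor \<open>1 / (g \<pi>)\<close> the Maxwellian is a half circle of radius \<open>sqrt (2 g h)\<close>, and
  a cubic times \<open>sqrt (r\<^sup>2 - x\<^sup>2)\<close> has the primitive \<open>A x * sqrt (r\<^sup>2 - x\<^sup>2) + K * arcsin (x / r)\<close>
  with a polynomial \<open>A\<close>. Degree three suffices for all that follows, because on its support the cube
  of a Maxwellian is a quadratic polynomial times the Maxwellian.
\<close>
lemma maxwellian_moments:
  fixes g h v a0 a1 a2 a3 :: real
  assumes g: "g > 0" and h: "h \<ge> 0"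
  shows "(LBINT \<xi>. (a0 + a1 * (\<xi> - v) + a2 * (\<xi> - v)\<^sup>2 + a3 * (\<xi> - v) ^ 3)
            * maxwellian g h v \<xi>) = a0 * h + a2 * (g * h\<^sup>2 / 2)"
proof (cases "h = 0")
  case True
  then show ?thesis using g by (simp add: maxwellian_dry)
next
  case False
  with h have hp: "h > 0" by simp
  define r where "r = sqrt (2 * g * h)"
  have r: "r > 0" and r2: "r\<^sup>2 = 2 * g * h" using g hp by (simp_all add: r_def)
  define P where "P x = r\<^sup>2 - x\<^sup>2" for x :: real
  define p where "p x = a0 + a1 * x + a2 * x\<^sup>2 + a3 * x ^ 3" for x :: real
  \<comment> \<open>\<open>K\<close> and \<open>A\<close> come from integrating by parts each monomial times \<open>sqrt (P x)\<close>;
    only the even monomials contribute to the coefficient \<open>K\<close> of the arcsine.\<close>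
  define K where "K = (a0 / 2 + a2 * r\<^sup>2 / 8) * r\<^sup>2"
  define A where "A x = (a0 / 2 + a2 * r\<^sup>2 / 8) * x - (a1 + a3 * r\<^sup>2) * P x / 3
      - a2 * x * P x / 4 + a3 * (P x)\<^sup>2 / 5" for x
  define A' where "A' x = (a0 / 2 + a2 * r\<^sup>2 / 8) + (a1 + a3 * r\<^sup>2) * (2 * x) / 3
      - a2 * (P x - 2 * x\<^sup>2) / 4 - a3 * (4 * x * P x) / 5" for x
  define F where "F x = A x * sqrt (P x) + K * arcsin (x / r)" for x
  have FTC: "((\<lambda>x. p x * sqrt (P x)) has_integral (F r - F (- r))) {-r..r}"
  proof (rule fundamental_theorem_of_calculus_interior)
    show "- r \<le> r" using r by simp
    show "continuous_on {- r..r} F"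
      unfolding F_def A_def P_def using r
      by (intro continuous_intros) (auto simp: field_simps)
    fix x assume x: "x \<in> {- r<..<r}"
    then have "x\<^sup>2 < r\<^sup>2" using r by (intro power2_strict_mono) auto
    then have Px: "P x > 0" by (simp add: P_def)
    define q where "q = sqrt (P x)"
    have q: "q > 0" "q * q = P x" using Px by (simp_all add: q_def)
    have dP: "(P has_real_derivative (- 2 * x)) (at x)"
      unfolding P_def by (auto intro!: derivative_eq_intros)
    have dA: "(A has_real_derivative A' x) (at x)"
      unfolding A_def A'_def using dP
      by (auto intro!: derivative_eq_intros simp: field_simps power2_eq_square)
    have dq: "((\<lambda>x. sqrt (P x)) has_real_derivative (- x / q)) (at x)"
      using dP Px by (auto intro!: derivative_eq_intros simp: q_def field_simps)
    have "1 - (x / r)\<^sup>2 = P x / r\<^sup>2"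
      using r by (simp add: P_def power_divide diff_divide_distrib)
    then have "sqrt (1 - (x / r)\<^sup>2) = q / r"
      using r by (simp add: q_def real_sqrt_divide)
    then have das: "((\<lambda>x. arcsin (x / r)) has_real_derivative (1 / q)) (at x)"
      using x r by (auto intro!: derivative_eq_intros simp: field_simps)
    have "(F has_real_derivative (A' x * q + A x * (- x / q) + K * (1 / q))) (at x)"
      unfolding F_def
      using DERIV_add[OF DERIV_mult[OF dA dq] DERIV_cmult[OF das, of K]]
      by (simp add: q_def algebra_simps)
    moreover have "A' x * q + A x * (- x / q) + K * (1 / q) = p x * q"
    proof -
      have "A' x * P x - A x * x + K = p x * P x"
        unfolding A_def A'_def K_def p_def P_def
        by (simp add: field_simps power2_eq_square power3_eq_cube)
      then have "(A' x * q * q - A x * x + K) / q = p x * q * q / q"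
        by (simp add: q(2) mult.assoc)
      then show ?thesis using q(1) by (simp add: add_divide_distrib diff_divide_distrib)
    qed
    ultimately show "(F has_vector_derivative p x * sqrt (P x)) (at x)"
      by (simp add: q_def has_real_derivative_iff_has_vector_derivative)
  qed
  \<comment> \<open>The square root vanishes at both ends, so only the arcsine contributes.\<close>
  have bd: "F r - F (- r) = K * pi"
    using r by (simp add: F_def P_def algebra_simps)
  let ?f = "\<lambda>x. p x * maxwellian g h 0 x"
  have ext: "?f x = (if x \<in> {-r..r} then 1 / (g * pi) * (p x * sqrt (P x)) else 0)" for x
  proof (cases "x \<in> {-r..r}")
    case True
    then have "x\<^sup>2 \<le> r\<^sup>2" using r by (auto simp: abs_le_square_iff[symmetric])
    then show ?thesis using True by (simp add: maxwellian_def P_def r2)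
  next
    case False
    then have "r\<^sup>2 \<le> x\<^sup>2" using r by (auto simp: abs_le_square_iff[symmetric])
    then show ?thesis using False by (auto simp: maxwellian_def r2)
  qed
  have "((\<lambda>x. 1 / (g * pi) * (p x * sqrt (P x))) has_integral (1 / (g * pi) * (K * pi))) {-r..r}"
    using has_integral_mult_right[OF FTC, of "1 / (g * pi)"] unfolding bd .
  then have HI: "(?f has_integral (1 / (g * pi) * (K * pi))) UNIV"
    unfolding ext has_integral_restrict_UNIV .
  have cc: "cont_csupp ?f"
    unfolding p_def by (intro cont_csupp_mult cont_csupp_maxwellian g h continuous_intros)
  have "(LBINT x. ?f x) = 1 / (g * pi) * (K * pi)"
    using integral_lborel[OF cont_csupp_integrable[OF cc]] integral_unique[OF HI] by simp
  also have "\<dots> = a0 * h + a2 * (g * h\<^sup>2 / 2)"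
    unfolding K_def r2 using g by (simp add: field_simps power2_eq_square)
  finally have *: "(LBINT x. ?f x) = a0 * h + a2 * (g * h\<^sup>2 / 2)" .
  have "(LBINT \<xi>. p (\<xi> - v) * maxwellian g h v \<xi>) = (LBINT x. ?f x)"
    using lborel_integral_real_affine[of 1 "\<lambda>\<xi>. p (\<xi> - v) * maxwellian g h v \<xi>" v]
    by (simp add: maxwellian_def)
  with * show ?thesis by (simp add: p_def)
qed

section \<open>The tangent of the kinetic entropy at a Maxwellian\<close>

text \<open>
  The gradient of the hydrostatic entropy \<open>h v\<^sup>2 / 2 + g h\<^sup>2 / 2 + g h z\<close> with respect to
  \<open>(h, h v)\<close>, paired with \<open>(1, \<xi>)\<close>.
\<close>
definition entropy_slope :: "real \<Rightarrow> real \<Rightarrow> real \<Rightarrow> real \<Rightarrow> real \<Rightarrow> real" where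
  "entropy_slope g h v z \<xi> = v * \<xi> - v\<^sup>2 / 2 + g * (h + z)"

text \<open>
  The derivative of the kinetic entropy in its argument \<open>f\<close>.
\<close>
definition kinetic_slope :: "real \<Rightarrow> real \<Rightarrow> real \<Rightarrow> real \<Rightarrow> real" where
  "kinetic_slope g f \<xi> z = \<xi>\<^sup>2 / 2 + g\<^sup>2 * pi\<^sup>2 / 2 * f\<^sup>2 + g * z"

text \<open>
  The Maxwellian solves the Euler--Lagrange conditions of the minimisation of the kinetic entropy
  under prescribed mass and momentum: its slope is affine in \<open>\<xi>\<close> on the support and lies above
  that affine function elsewhere.
\<close>
lemma kinetic_slope_maxwellian:
  assumes "g > 0"
  shows "entropy_slope g h v z \<xi> \<le> kinetic_slope g (maxwellian g h v \<xi>) \<xi> z"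
    and "maxwellian g h v \<xi> > 0 \<Longrightarrow>
      kinetic_slope g (maxwellian g h v \<xi>) \<xi> z = entropy_slope g h v z \<xi>"
proof -
  have *: "kinetic_slope g (maxwellian g h v \<xi>) \<xi> z
      = \<xi>\<^sup>2 / 2 + max (2 * g * h - (\<xi> - v)\<^sup>2) 0 / 2 + g * z"
    using maxwellian_square[OF assms, of h v \<xi>] by (simp add: kinetic_slope_def)
  have **: "entropy_slope g h v z \<xi> = \<xi>\<^sup>2 / 2 + (2 * g * h - (\<xi> - v)\<^sup>2) / 2 + g * z"
    by (simp add: entropy_slope_def field_simps power2_eq_square)
  show "entropy_slope g h v z \<xi> \<le> kinetic_slope g (maxwellian g h v \<xi>) \<xi> z"
    unfolding * ** by (intro add_right_mono add_left_mono divide_right_mono) auto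
  show "maxwellian g h v \<xi> > 0 \<Longrightarrow>
      kinetic_slope g (maxwellian g h v \<xi>) \<xi> z = entropy_slope g h v z \<xi>"
    using maxwellian_pos_imp[OF assms, of h v \<xi>] unfolding * ** by simp
qed

text \<open>
  The entropy is cubic in \<open>f\<close>, so its Taylor formula is exact; the remainder is nonnegative for
  nonnegative \<open>m\<close> and \<open>f\<close>, which expresses convexity in quantitative form.
\<close>
lemma kinetic_entropy_taylor:
  "kinetic_entropy g f \<xi> z = kinetic_entropy g m \<xi> z + kinetic_slope g m \<xi> z * (f - m)
     + g\<^sup>2 * pi\<^sup>2 / 6 * ((2 * m + f) * (f - m)\<^sup>2)"
  by (simp add: kinetic_entropy_def kinetic_slope_def field_simps power2_eq_square power3_eq_cube)

lemma kinetic_slope_times_maxwellian_diff: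
  assumes "g > 0" "f \<ge> 0"
  shows "entropy_slope g h v z \<xi> * (f - maxwellian g h v \<xi>)
      \<le> kinetic_slope g (maxwellian g h v \<xi>) \<xi> z * (f - maxwellian g h v \<xi>)"
  using kinetic_slope_maxwellian[OF assms(1), where h=h and v=v and z=z and \<xi>=\<xi>]
    maxwellian_nonneg[OF assms(1), of h v \<xi>] assms(2)
  by (cases "maxwellian g h v \<xi> > 0") (auto intro: mult_right_mono)

lemma maxwellian_mass:
  "g > 0 \<Longrightarrow> h \<ge> 0 \<Longrightarrow> (LBINT \<xi>. maxwellian g h v \<xi>) = h"
  using maxwellian_moments[of g h 1 0 v 0 0] by simp

lemma maxwellian_momentum_centred:
  "g > 0 \<Longrightarrow> h \<ge> 0 \<Longrightarrow> (LBINT \<xi>. (\<xi> - v) * maxwellian g h v \<xi>) = 0"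
  using maxwellian_moments[of g h 0 1 v 0 0] by simp

lemma integral_entropy_slope_maxwellian:
  assumes "g > 0" "h' \<ge> 0"
  shows "(LBINT \<xi>. entropy_slope g h v z \<xi> * maxwellian g h' v \<xi>) = h' * (v\<^sup>2 / 2 + g * (h + z))"
proof -
  have "entropy_slope g h v z \<xi> = (v\<^sup>2 / 2 + g * (h + z)) + v * (\<xi> - v)" for \<xi>
    by (simp add: entropy_slope_def field_simps power2_eq_square)
  then show ?thesis
    using maxwellian_moments[OF assms, of "v\<^sup>2 / 2 + g * (h + z)" v v 0 0] by simp
qed

lemma kinetic_entropy_maxwellian:
  assumes "g > 0"
  shows "kinetic_entropy g (maxwellian g h v \<xi>) \<xi> z
    = ((v\<^sup>2 / 2 + g * h / 3 + g * z) + v * (\<xi> - v) + 1 / 3 * (\<xi> - v)\<^sup>2)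
        * maxwellian g h v \<xi>"
proof (cases "maxwellian g h v \<xi> > 0")
  case True
  let ?m = "maxwellian g h v \<xi>"
  have sq: "g\<^sup>2 * pi\<^sup>2 * ?m\<^sup>2 = 2 * g * h - (\<xi> - v)\<^sup>2"
    using maxwellian_square[OF assms, of h v \<xi>] maxwellian_pos_imp[OF assms True] by simp
  have "kinetic_entropy g ?m \<xi> z = (\<xi>\<^sup>2 / 2 + g\<^sup>2 * pi\<^sup>2 * ?m\<^sup>2 / 6 + g * z) * ?m"
    by (simp add: kinetic_entropy_def algebra_simps power3_eq_cube power2_eq_square)
  also have "\<dots> = (\<xi>\<^sup>2 / 2 + (2 * g * h - (\<xi> - v)\<^sup>2) / 6 + g * z) * ?m" by (simp only: sq)
  also have "\<xi>\<^sup>2 / 2 + (2 * g * h - (\<xi> - v)\<^sup>2) / 6 + g * z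
      = (v\<^sup>2 / 2 + g * h / 3 + g * z) + v * (\<xi> - v) + 1 / 3 * (\<xi> - v)\<^sup>2"
    by (simp add: field_simps power2_eq_square)
  finally show ?thesis .
next
  case False
  then have "maxwellian g h v \<xi> = 0" using maxwellian_nonneg[OF assms, of h v \<xi>] by simp
  then show ?thesis by (simp add: kinetic_entropy_def)
qed

lemma integral_kinetic_entropy_maxwellian:
  assumes "g > 0" "h \<ge> 0"
  shows "(LBINT \<xi>. kinetic_entropy g (maxwellian g h v \<xi>) \<xi> z)
      = h * v\<^sup>2 / 2 + g * h\<^sup>2 / 2 + g * h * z"
proof -
  have "(LBINT \<xi>. kinetic_entropy g (maxwellian g h v \<xi>) \<xi> z)
     = (v\<^sup>2 / 2 + g * h / 3 + g * z) * h + 1 / 3 * (g * h\<^sup>2 / 2)"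
    unfolding kinetic_entropy_maxwellian[OF assms(1)]
    using maxwellian_moments[OF assms, of "v\<^sup>2 / 2 + g * h / 3 + g * z" v v "1 / 3" 0] by simp
  then show ?thesis by (simp add: field_simps power2_eq_square)
qed

text \<open>
  The interface terms that remain once the incoming fluxes have been compared by convexity integrate
  to zero on each side of the cell. This is where well-balancing enters: the identity needs the
  reconstructed free surface \<open>h + z\<close> to be that of the cell, unless the reconstructed state is dry.
\<close>
lemma integral_entropy_flux_balance:
  assumes g: "g > 0" and h: "h \<ge> 0" and hz: "h = 0 \<or> h + z = h0 + z0"
  shows "(LBINT \<xi>. \<xi> * kinetic_entropy g (maxwellian g h v \<xi>) \<xi> z
            - v * entropy_slope g h0 v z0 \<xi> * maxwellian g h v \<xi>) = 0"
proof (cases "h = 0")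
  case True
  then show ?thesis using g by (simp add: maxwellian_dry kinetic_entropy_def)
next
  case False
  then have e: "h0 + z0 = h + z" using hz by simp
  define a0 a1 where "a0 = v * (v\<^sup>2 / 2 + g * h / 3 + g * z) - v * (v\<^sup>2 / 2 + g * (h + z))"
    and "a1 = (v\<^sup>2 / 2 + g * h / 3 + g * z)"
  have eq: "\<xi> * kinetic_entropy g (maxwellian g h v \<xi>) \<xi> z
            - v * entropy_slope g h0 v z0 \<xi> * maxwellian g h v \<xi>
      = (a0 + a1 * (\<xi> - v) + (4 / 3 * v) * (\<xi> - v)\<^sup>2 + 1 / 3 * (\<xi> - v) ^ 3)
          * maxwellian g h v \<xi>" for \<xi>
    unfolding kinetic_entropy_maxwellian[OF g, of h v \<xi> z] entropy_slope_def e a0_def a1_def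
    by (simp add: field_simps power2_eq_square power3_eq_cube)
  show ?thesis
    unfolding eq maxwellian_moments[OF g h]
    by (simp add: a0_def field_simps power2_eq_square)
qed

section \<open>Estimates for one explicit upwind step\<close>

text \<open>
  The second order term of the Taylor formula for one explicit step. Here \<open>m\<close> stands for the cell
  Maxwellian, \<open>l\<close> and \<open>r\<close> for the reconstructed ones, \<open>n\<close> for the density coming in from the
  upwind neighbour, and \<open>a\<close>, \<open>b\<close> for \<open>\<sigma> \<xi>\<close>, \<open>\<sigma> v\<close>. The first term on the right is linear in the
  time step and is exactly the dissipation that convexity gives for the incoming jump \<open>n - l\<close>; the
  quadratic contribution of that jump is absorbed by it under the CFL condition. What is left is
  quadratic in the time step and involves only the distances of \<open>m\<close> to \<open>l\<close> and \<open>r\<close>, that is,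
  the topography jumps. The constants \<open>1 / 64\<close> and \<open>20\<close> are convenient rather than sharp.
\<close>
lemma upwind_remainder:
  fixes a b m l r n s :: real
  assumes l: "0 \<le> l" "l \<le> m" and r: "0 \<le> r" "r \<le> m" and n: "0 \<le> n"
    and a: "0 \<le> a" "a \<le> s" and b: "\<bar>b\<bar> \<le> s" and s: "s \<le> 1 / 64"
    and f: "f = m + a * (n - l) - b * (r - l)"
  shows "(2 * m + f) * (f - m)\<^sup>2
      \<le> a * ((2 * l + n) * (n - l)\<^sup>2) + 20 * s\<^sup>2 * (m * ((m - l)\<^sup>2 + (m - r)\<^sup>2))"
proof -
  define d e q S where "d = n - l" and "e = r - l" and "q = 2 * l + n"
    and "S = (m - l)\<^sup>2 + (m - r)\<^sup>2"
  have s0: "0 \<le> s" and a64: "a \<le> 1 / 64" and m0: "0 \<le> m" using a s l by linarith+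
  have q0: "0 \<le> q" and S0: "0 \<le> S" using l n by (simp_all add: q_def S_def)
  have dq: "\<bar>d\<bar> \<le> q" and em: "\<bar>e\<bar> \<le> m" using l r n by (auto simp: d_def q_def e_def abs_if)
  have eS: "e\<^sup>2 \<le> S"
  proof (cases "r \<le> l")
    case True
    then have "e\<^sup>2 \<le> (m - r)\<^sup>2" using l by (intro abs_le_square_iff[THEN iffD1]) (auto simp: e_def)
    then show ?thesis by (simp add: S_def add_increasing)
  next
    case False
    then have "e\<^sup>2 \<le> (m - l)\<^sup>2" using r by (intro abs_le_square_iff[THEN iffD1]) (auto simp: e_def)
    then show ?thesis by (simp add: S_def add_increasing2)
  qed
  have a2: "a\<^sup>2 \<le> a / 64" using mult_left_mono[OF a64 a(1)] by (simp add: power2_eq_square)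
  have a2s: "a\<^sup>2 \<le> s\<^sup>2" using a by (intro power_mono) auto
  have b2s: "b\<^sup>2 \<le> s\<^sup>2" using b s0 by (simp add: abs_le_square_iff[symmetric])
  have s21: "s\<^sup>2 \<le> 1" using s s0 by (simp add: power_le_one)
  have fm: "f - m = a * d - b * e" by (simp add: f d_def e_def)
  have sq: "(f - m)\<^sup>2 \<le> 2 * (a\<^sup>2 * d\<^sup>2) + 2 * (b\<^sup>2 * e\<^sup>2)"
  proof -
    have "0 \<le> (a * d + b * e)\<^sup>2" by simp
    then show ?thesis unfolding fm by (simp add: power2_eq_square algebra_simps)
  qed
  have be: "\<bar>b * e\<bar> \<le> m"
    using mult_mono[of "\<bar>b\<bar>" 1 "\<bar>e\<bar>" m] b s em by (simp add: abs_mult)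
  have "a * d \<le> a * n" using a l by (intro mult_left_mono) (auto simp: d_def)
  then have mf: "2 * m + f \<le> 4 * m + a * n" using be by (simp add: f d_def e_def)
  \<comment> \<open>Either \<open>m\<close> is controlled by \<open>q\<close>, and the dissipation absorbs the term, or the jump
    \<open>d\<close> is smaller than \<open>m - l\<close>, and the term is part of the topography error.\<close>
  have t1: "m * (a\<^sup>2 * d\<^sup>2) \<le> 2 * a\<^sup>2 * (q * d\<^sup>2) + s\<^sup>2 * (m * S)"
  proof (cases "m - l \<le> q")
    case True
    then have "m \<le> 2 * q" using l n by (simp add: q_def)
    then have "m * (a\<^sup>2 * d\<^sup>2) \<le> 2 * q * (a\<^sup>2 * d\<^sup>2)" by (intro mult_right_mono) auto
    moreover have "0 \<le> s\<^sup>2 * (m * S)" using m0 S0 by simp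
    ultimately show ?thesis by (simp add: mult_ac)
  next
    case False
    then have "\<bar>d\<bar> \<le> \<bar>m - l\<bar>" using dq l by linarith
    then have "d\<^sup>2 \<le> (m - l)\<^sup>2" by (simp add: abs_le_square_iff)
    then have "d\<^sup>2 \<le> S" by (simp add: S_def add_increasing2)
    then have "m * (a\<^sup>2 * d\<^sup>2) \<le> m * (s\<^sup>2 * S)"
      using a2s m0 by (intro mult_left_mono mult_mono) auto
    moreover have "0 \<le> 2 * a\<^sup>2 * (q * d\<^sup>2)" using q0 by simp
    ultimately show ?thesis by (simp add: mult_ac)
  qed
  have t2: "a * n * (a\<^sup>2 * d\<^sup>2) \<le> a\<^sup>2 * (q * d\<^sup>2)"
  proof -
    have "a * n \<le> 1 * q" using a a64 l n by (intro mult_mono) (auto simp: q_def)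
    then have "a * n * (a\<^sup>2 * d\<^sup>2) \<le> q * (a\<^sup>2 * d\<^sup>2)" by (intro mult_right_mono) auto
    then show ?thesis by (simp add: mult_ac)
  qed
  have t3: "m * (b\<^sup>2 * e\<^sup>2) \<le> s\<^sup>2 * (m * S)"
  proof -
    have "m * (b\<^sup>2 * e\<^sup>2) \<le> m * (s\<^sup>2 * S)"
      using b2s eS m0 by (intro mult_left_mono mult_mono) auto
    then show ?thesis by (simp add: mult_ac)
  qed
  \<comment> \<open>The same alternative: a large \<open>n\<close> forces a large jump \<open>d\<close>.\<close>
  have t4: "a * n * (b\<^sup>2 * e\<^sup>2) \<le> a / 64 * (q * d\<^sup>2) + s\<^sup>2 * (m * S)"
  proof (cases "n \<le> 2 * m")
    case True
    then have "a * n \<le> 1 / 64 * (2 * m)" using a a64 n by (intro mult_mono) auto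
    then have "a * n \<le> m" using m0 by simp
    then have "a * n * (b\<^sup>2 * e\<^sup>2) \<le> m * (b\<^sup>2 * e\<^sup>2)" by (intro mult_right_mono) auto
    moreover have "0 \<le> a / 64 * (q * d\<^sup>2)" using a q0 by simp
    ultimately show ?thesis using t3 by linarith
  next
    case False
    then have "\<bar>e\<bar> \<le> \<bar>d\<bar>" using em l by (simp add: d_def)
    then have ed: "e\<^sup>2 \<le> d\<^sup>2" by (simp add: abs_le_square_iff)
    have "b\<^sup>2 \<le> 1 / 64"
      using b2s mult_mono[OF s s _ s0] s0 by (simp add: power2_eq_square)
    then have be2: "b\<^sup>2 * e\<^sup>2 \<le> 1 / 64 * d\<^sup>2" using ed by (intro mult_mono) auto
    have "n \<le> q" using l by (simp add: q_def)
    then have "a * n \<le> a * q" using a(1) by (rule mult_left_mono)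
    from mult_mono[OF this be2] have "(a * n) * (b\<^sup>2 * e\<^sup>2) \<le> (a * q) * (1 / 64 * d\<^sup>2)"
      using a q0 by simp
    moreover have "0 \<le> s\<^sup>2 * (m * S)" using m0 S0 by simp
    ultimately show ?thesis by simp
  qed
  have t5: "a\<^sup>2 * (q * d\<^sup>2) \<le> a / 64 * (q * d\<^sup>2)"
    using a2 q0 by (intro mult_right_mono) auto
  have aq: "0 \<le> a * (q * d\<^sup>2)" and ss: "0 \<le> s\<^sup>2 * (m * S)" using a q0 m0 S0 by simp_all
  have "(2 * m + f) * (f - m)\<^sup>2 \<le> (4 * m + a * n) * (f - m)\<^sup>2"
    using mf by (rule mult_right_mono) simp
  also have "\<dots> \<le> (4 * m + a * n) * (2 * (a\<^sup>2 * d\<^sup>2) + 2 * (b\<^sup>2 * e\<^sup>2))"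
    using sq m0 a n by (intro mult_left_mono) auto
  also have "\<dots> = 8 * (m * (a\<^sup>2 * d\<^sup>2)) + 8 * (m * (b\<^sup>2 * e\<^sup>2))
      + 2 * (a * n * (a\<^sup>2 * d\<^sup>2)) + 2 * (a * n * (b\<^sup>2 * e\<^sup>2))"
    by (simp add: algebra_simps)
  also have "\<dots> \<le> a * (q * d\<^sup>2) + 20 * (s\<^sup>2 * (m * S))"
    using t1 t2 t3 t4 t5 aq ss by (simp add: mult.assoc)
  finally show ?thesis by (simp add: d_def q_def S_def mult.assoc)
qed

lemma weighted_mean_square:
  fixes a b c x y z :: real
  assumes "a \<ge> 0" "b \<ge> 0" "c \<ge> 0"
  shows "(a + b + c) * ((a * x + b * y + c * z) / (a + b + c))\<^sup>2 \<le> a * x\<^sup>2 + b * y\<^sup>2 + c * z\<^sup>2"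
proof (cases "a + b + c = 0")
  case True
  then show ?thesis using assms by simp
next
  case False
  define N where "N = a + b + c"
  have N: "N > 0" using False assms unfolding N_def by linarith
  have "N * (a * x\<^sup>2 + b * y\<^sup>2 + c * z\<^sup>2) - (a * x + b * y + c * z)\<^sup>2
      = a * b * (x - y)\<^sup>2 + a * c * (x - z)\<^sup>2 + b * c * (y - z)\<^sup>2"
    by (simp add: N_def power2_eq_square algebra_simps)
  also have "\<dots> \<ge> 0" using assms by simp
  finally have "(a * x + b * y + c * z)\<^sup>2 \<le> N * (a * x\<^sup>2 + b * y\<^sup>2 + c * z\<^sup>2)" by simp
  then show ?thesis
    using N unfolding N_def[symmetric] by (simp add: power_divide power2_eq_square[of N] divide_le_eq mult.commute)
qed

section \<open>Hydrostatic reconstruction and convexity\<close>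

text \<open>
  What the proof uses of a hydrostatic reconstruction \<open>(h', z')\<close> of a cell \<open>(h, z)\<close>: the bottom
  is raised, the depth does not grow, the free surface is kept unless the reconstructed state is dry,
  and in that case the raised bottom is above the free surface.
\<close>
definition reconstructed :: "real \<Rightarrow> real \<Rightarrow> real \<Rightarrow> real \<Rightarrow> bool" where
  "reconstructed h z h' z' \<longleftrightarrow> 0 \<le> h' \<and> h' \<le> h \<and> z \<le> z' \<and> h + z \<le> h' + z' \<and>
     (h' = 0 \<or> h' + z' = h + z)"

lemma reconstructed_max:
  assumes "h \<ge> 0" "z \<le> z'"
  shows "reconstructed h z (max (h + z - z') 0) z'"
  using assms by (auto simp: reconstructed_def)

text \<open>
  The slope of the cell entropy depends on depth and bottom only through the free surface. It is
  therefore also a subtangent at the reconstructed Maxwellian for the raised bottom.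
\<close>
lemma entropy_slope_reconstructed:
  assumes g: "g > 0" and rec: "reconstructed h z h' z'" and n: "n \<ge> 0"
  shows "entropy_slope g h v z \<xi> * (n - maxwellian g h' v \<xi>)
      \<le> kinetic_slope g (maxwellian g h' v \<xi>) \<xi> z' * (n - maxwellian g h' v \<xi>)"
proof (cases "maxwellian g h' v \<xi> > 0")
  case True
  then have "h' \<noteq> 0" using maxwellian_dry[OF g, of v \<xi>] by auto
  then have "h + z = h' + z'" using rec by (simp add: reconstructed_def)
  then have "entropy_slope g h v z \<xi> = entropy_slope g h' v z' \<xi>"
    by (simp only: entropy_slope_def)
  then show ?thesis using kinetic_slope_maxwellian(2)[OF g True] by simp
next
  case False
  have "g * (h + z) \<le> g * (h' + z')" using rec g by (simp add: reconstructed_def)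
  then have "entropy_slope g h v z \<xi> \<le> entropy_slope g h' v z' \<xi>"
    by (simp only: entropy_slope_def add_left_mono)
  also note kinetic_slope_maxwellian(1)[OF g]
  finally show ?thesis
    using False n maxwellian_nonneg[OF g, of h' v \<xi>] by (intro mult_right_mono) auto
qed

text \<open>
  Integrating the tangent inequality at the Maxwellian with the moments of \<open>f\<close> makes the linear
  term vanish. In the dry case \<open>h = 0\<close> it vanishes too, because then the quotient \<open>p / h\<close> is \<open>0\<close>.
\<close>
lemma maxwellian_minimises_entropy:
  assumes g: "g > 0" and f: "cont_csupp f" and f0: "\<And>\<xi>. f \<xi> \<ge> 0"
    and mass: "(LBINT \<xi>. f \<xi>) = h" and mom: "(LBINT \<xi>. \<xi> * f \<xi>) = p"
  shows "h / 2 * (p / h)\<^sup>2 + g / 2 * h\<^sup>2 + g * h * z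
      \<le> (LBINT \<xi>. kinetic_entropy g (f \<xi>) \<xi> z)"
proof -
  define v where "v = p / h"
  have h: "h \<ge> 0" using f0 by (simp add: mass[symmetric])
  let ?M = "maxwellian g h v"
  let ?T = "entropy_slope g h v z"
  have cM: "cont_csupp ?M" by (rule cont_csupp_maxwellian[OF g h])
  have cT: "continuous_on UNIV ?T" unfolding entropy_slope_def by (intro continuous_intros)
  note ci = cont_csupp_integrable
  have pw: "kinetic_entropy g (?M \<xi>) \<xi> z + (?T \<xi> * f \<xi> - ?T \<xi> * ?M \<xi>)
      \<le> kinetic_entropy g (f \<xi>) \<xi> z" for \<xi>
  proof -
    have "0 \<le> g\<^sup>2 * pi\<^sup>2 / 6 * ((2 * ?M \<xi> + f \<xi>) * (f \<xi> - ?M \<xi>)\<^sup>2)"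
      using f0[of \<xi>] maxwellian_nonneg[OF g, of h v \<xi>] by simp
    then show ?thesis
      using kinetic_slope_times_maxwellian_diff[OF g f0[of \<xi>], of h v z \<xi>]
        kinetic_entropy_taylor[of g "f \<xi>" \<xi> z "?M \<xi>"]
      by (simp add: right_diff_distrib)
  qed
  have "(LBINT \<xi>. ?T \<xi> * f \<xi>) = (LBINT \<xi>. v * (\<xi> * f \<xi>) + (g * (h + z) - v\<^sup>2 / 2) * f \<xi>)"
    by (simp add: entropy_slope_def algebra_simps)
  also have "\<dots> = v * p + (g * (h + z) - v\<^sup>2 / 2) * h"
    by (subst Bochner_Integration.integral_add)
      (auto intro!: ci cont_csupp_intros f continuous_intros simp: mass mom)
  also have "v * p = h * v\<^sup>2"
    by (cases "h = 0") (simp_all add: v_def power2_eq_square)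
  finally have Tf: "(LBINT \<xi>. ?T \<xi> * f \<xi>) = h * (v\<^sup>2 / 2 + g * (h + z))"
    by (simp add: algebra_simps)
  have "h * v\<^sup>2 / 2 + g * h\<^sup>2 / 2 + g * h * z
     = (LBINT \<xi>. kinetic_entropy g (?M \<xi>) \<xi> z + (?T \<xi> * f \<xi> - ?T \<xi> * ?M \<xi>))"
    using Tf integral_entropy_slope_maxwellian[OF g h, of h v z]
      integral_kinetic_entropy_maxwellian[OF g h, of v z]
    by (simp only: Bochner_Integration.integral_add Bochner_Integration.integral_diff ci
        cont_csupp_diff cont_csupp_mult cont_csupp_kinetic_entropy cM f cT)
  also have "\<dots> \<le> (LBINT \<xi>. kinetic_entropy g (f \<xi>) \<xi> z)"
    by (intro integral_mono ci cont_csupp_add cont_csupp_diff cont_csupp_mult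
        cont_csupp_kinetic_entropy cM f cT pw)
  finally show ?thesis by (simp add: v_def mult_ac)
qed

text \<open>
  The Taylor remainder at the larger Maxwellian, evaluated at the smaller one, is at least twice the
  integrand. Its integral is the convexity defect of the macroscopic entropy between
  two states of equal velocity, which is \<open>g / 2 * (h - h')\<^sup>2\<close>; this bounds the kinetic error by the
  jump of depth even though the Maxwellian is not Lipschitz in \<open>h\<close>.
\<close>
lemma integral_maxwellian_distance:
  assumes g: "g > 0" and h: "0 \<le> h'" "h' \<le> h"
  shows "(LBINT \<xi>. g\<^sup>2 * pi\<^sup>2 / 6 * (maxwellian g h v \<xi> * (maxwellian g h v \<xi> - maxwellian g h' v \<xi>)\<^sup>2))
      \<le> g / 4 * (h - h')\<^sup>2"
proof -
  let ?M = "maxwellian g h v" and ?L = "maxwellian g h' v"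
  let ?T = "entropy_slope g h v 0"
  let ?k = "g\<^sup>2 * pi\<^sup>2 / 6"
  note ci = cont_csupp_integrable
  have h0: "0 \<le> h" using h by linarith
  have cM: "cont_csupp ?M" and cL: "cont_csupp ?L"
    by (auto intro: cont_csupp_maxwellian g h h0)
  have cT: "continuous_on UNIV ?T" unfolding entropy_slope_def by (intro continuous_intros)
  have cML: "continuous_on UNIV (\<lambda>\<xi>. ?M \<xi> - ?L \<xi>)"
    by (intro continuous_intros cont_csupp_continuous cM cL)
  let ?E = "\<lambda>\<xi>. 1 / 2 * ((kinetic_entropy g (?L \<xi>) \<xi> 0 - kinetic_entropy g (?M \<xi>) \<xi> 0)
      - (?T \<xi> * ?L \<xi> - ?T \<xi> * ?M \<xi>))"
  \<comment> \<open>\<open>D\<close> is the Taylor remainder, \<open>A\<close> the integrand, \<open>C\<close> the part of \<open>D\<close> that is dropped,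
    and \<open>t \<le> K\<close> compares the affine slope with the kinetic one.\<close>
  have halve: "A \<le> 1 / 2 * ((EL - EM) - t)" if "0 \<le> C" "D = 2 * A + C" "t \<le> K" "EL = EM + K + D"
    for A C D K EL EM t :: real
    using that by (simp add: field_simps)
  have pw: "?k * (?M \<xi> * (?M \<xi> - ?L \<xi>)\<^sup>2) \<le> ?E \<xi>" for \<xi>
  proof -
    have "0 \<le> ?k * (?L \<xi> * (?M \<xi> - ?L \<xi>)\<^sup>2)"
      using maxwellian_nonneg[OF g, of h' v \<xi>] by simp
    moreover have "?k * ((2 * ?M \<xi> + ?L \<xi>) * (?L \<xi> - ?M \<xi>)\<^sup>2)
        = 2 * (?k * (?M \<xi> * (?M \<xi> - ?L \<xi>)\<^sup>2)) + ?k * (?L \<xi> * (?M \<xi> - ?L \<xi>)\<^sup>2)"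
      by (simp add: power2_eq_square algebra_simps)
    moreover have "?T \<xi> * ?L \<xi> - ?T \<xi> * ?M \<xi>
        \<le> kinetic_slope g (?M \<xi>) \<xi> 0 * (?L \<xi> - ?M \<xi>)"
      using kinetic_slope_times_maxwellian_diff[OF g, of "?L \<xi>" h v 0 \<xi>]
        maxwellian_nonneg[OF g, of h' v \<xi>] by (simp add: right_diff_distrib)
    ultimately show ?thesis
      using kinetic_entropy_taylor[of g "?L \<xi>" \<xi> 0 "?M \<xi>"] by (rule halve)
  qed
  have "(LBINT \<xi>. ?k * (?M \<xi> * (?M \<xi> - ?L \<xi>)\<^sup>2)) \<le> (LBINT \<xi>. ?E \<xi>)"
  proof (rule integral_mono)
    have "cont_csupp (\<lambda>\<xi>. ?k * (?M \<xi> - ?L \<xi>)\<^sup>2 * ?M \<xi>)"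
      by (intro cont_csupp_mult cM continuous_intros cML)
    then show "integrable lborel (\<lambda>\<xi>. ?k * (?M \<xi> * (?M \<xi> - ?L \<xi>)\<^sup>2))"
      using ci by (simp add: mult_ac)
    show "integrable lborel ?E"
      by (intro ci cont_csupp_cmult cont_csupp_diff cont_csupp_mult cont_csupp_kinetic_entropy cM cL cT)
  qed (rule pw)
  also have "(LBINT \<xi>. ?E \<xi>) = 1 / 2 * (((LBINT \<xi>. kinetic_entropy g (?L \<xi>) \<xi> 0)
       - (LBINT \<xi>. kinetic_entropy g (?M \<xi>) \<xi> 0))
      - ((LBINT \<xi>. ?T \<xi> * ?L \<xi>) - (LBINT \<xi>. ?T \<xi> * ?M \<xi>)))"
    by (simp only: integral_mult_right_zero Bochner_Integration.integral_diff ci cont_csupp_diff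
        cont_csupp_mult cont_csupp_kinetic_entropy cM cL cT)
  also have "\<dots> = g / 4 * (h - h')\<^sup>2"
    unfolding integral_kinetic_entropy_maxwellian[OF g h(1)] integral_kinetic_entropy_maxwellian[OF g h0]
      integral_entropy_slope_maxwellian[OF g h(1)] integral_entropy_slope_maxwellian[OF g h0]
    by (simp add: field_simps power2_eq_square)
  finally show ?thesis .
qed

text \<open>
  Inside the support of the cell Maxwellian the linear part of the Taylor formula splits into the
  incoming jump, which convexity at the reconstructed Maxwellian compares with entropy fluxes, and the
  term in \<open>b\<close>, whose integral cancels later. Outside the support only the incoming density is present
  and the inequality is the elementary scaling \<open>a\<^sup>3 \<le> a\<close> together with \<open>z \<le> z'\<close>.
\<close>
lemma pointwise_upwind_entropy:
  assumes g: "g > 0" and rec: "reconstructed h z h' z'"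
    and n: "0 \<le> n" and r: "0 \<le> r" "r \<le> maxwellian g h v \<xi>"
    and a: "0 \<le> a" "a \<le> s" and b: "\<bar>b\<bar> \<le> s" and s: "s \<le> 1 / 64"
    and m: "m = maxwellian g h v \<xi>" and l: "l = maxwellian g h' v \<xi>"
    and f: "f = m + a * (n - l) - b * (r - l)"
  shows "kinetic_entropy g f \<xi> z \<le> kinetic_entropy g m \<xi> z
      + a * (kinetic_entropy g n \<xi> z' - kinetic_entropy g l \<xi> z')
      - b * entropy_slope g h v z \<xi> * (r - l)
      + g\<^sup>2 * pi\<^sup>2 / 6 * (20 * s\<^sup>2 * (m * ((m - l)\<^sup>2 + (m - r)\<^sup>2)))"
proof (cases "m > 0")
  case True
  let ?T = "entropy_slope g h v z \<xi>"
  let ?k = "g\<^sup>2 * pi\<^sup>2 / 6"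
  have l0: "0 \<le> l" "l \<le> m"
    using rec g by (auto simp: l m reconstructed_def intro: maxwellian_nonneg maxwellian_mono)
  have taylor: "kinetic_entropy g f \<xi> z = kinetic_entropy g m \<xi> z
      + ?T * (f - m) + ?k * ((2 * m + f) * (f - m)\<^sup>2)"
    using kinetic_entropy_taylor[of g f \<xi> z m] kinetic_slope_maxwellian(2)[OF g, of h v \<xi> z] True
    by (simp add: m)
  have "?T * (n - l) \<le> kinetic_slope g l \<xi> z' * (n - l)"
    unfolding l by (rule entropy_slope_reconstructed[OF g rec n])
  then have "?T * (n - l) + ?k * ((2 * l + n) * (n - l)\<^sup>2)
      \<le> kinetic_entropy g n \<xi> z' - kinetic_entropy g l \<xi> z'"
    using kinetic_entropy_taylor[of g n \<xi> z' l] by simp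
  from mult_left_mono[OF this a(1)]
  have incoming: "a * (?T * (n - l)) + a * (?k * ((2 * l + n) * (n - l)\<^sup>2))
      \<le> a * (kinetic_entropy g n \<xi> z' - kinetic_entropy g l \<xi> z')"
    by (simp add: distrib_left)
  have rem: "?k * ((2 * m + f) * (f - m)\<^sup>2)
      \<le> ?k * (a * ((2 * l + n) * (n - l)\<^sup>2) + 20 * s\<^sup>2 * (m * ((m - l)\<^sup>2 + (m - r)\<^sup>2)))"
    by (rule mult_left_mono[OF upwind_remainder[OF l0 r(1) r(2)[folded m] n a b s f]]) simp
  have "?T * (f - m) = a * (?T * (n - l)) - b * ?T * (r - l)"
    by (simp add: f algebra_simps)
  then show ?thesis using taylor incoming rem by (simp add: distrib_left mult_ac)
next
  case False
  then have m0: "m = 0" using maxwellian_nonneg[OF g, of h v \<xi>] m by simp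
  have "l \<le> m" "0 \<le> l"
    using rec g by (auto simp: l m reconstructed_def intro: maxwellian_nonneg maxwellian_mono)
  then have l0: "l = 0" and r0: "r = 0" using r m m0 by auto
  have fn: "f = a * n" by (simp add: f m0 l0 r0)
  have a1: "a \<le> 1" using a s by simp
  have "a ^ 3 \<le> a ^ 1" by (rule power_decreasing) (use a a1 in auto)
  then have "g\<^sup>2 * pi\<^sup>2 / 6 * n ^ 3 * a ^ 3 \<le> g\<^sup>2 * pi\<^sup>2 / 6 * n ^ 3 * a"
    using n by (intro mult_left_mono) auto
  moreover have "(a * n * g) * z \<le> (a * n * g) * z'"
    using rec a n g by (intro mult_left_mono) (auto simp: reconstructed_def)
  ultimately have "kinetic_entropy g (a * n) \<xi> z \<le> a * kinetic_entropy g n \<xi> z'"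
    by (simp only: kinetic_entropy_def power_mult_distrib distrib_left mult_ac)
  then show ?thesis by (simp add: fn m0 l0 r0) (simp add: kinetic_entropy_def)
qed

section \<open>The prediction step in a single cell\<close>

text \<open>
  One cell with depth \<open>h\<close>, velocity \<open>v\<close> and bottom \<open>z\<close>; \<open>l\<close> and \<open>r\<close> mark its two interfaces.
  The entropy of the entering densities \<open>NL\<close> and \<open>NR\<close> is compared with that of the reconstructed
  Maxwellians by convexity alone, so they are general nonnegative densities with speeds at most \<open>V\<close>.
\<close>
locale kinetic_cell =
  fixes g h v z hl zl hr zr \<sigma> V :: real and NL NR :: "real \<Rightarrow> real"
  assumes g: "g > 0" and h: "h \<ge> 0"
    and recl: "reconstructed h z hl zl" and recr: "reconstructed h z hr zr"
    and NL: "cont_csupp NL" "\<And>\<xi>. NL \<xi> \<ge> 0" "\<And>\<xi>. \<bar>\<xi>\<bar> > V \<Longrightarrow> NL \<xi> = 0"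
    and NR: "cont_csupp NR" "\<And>\<xi>. NR \<xi> \<ge> 0" "\<And>\<xi>. \<bar>\<xi>\<bar> > V \<Longrightarrow> NR \<xi> = 0"
    and V: "\<bar>v\<bar> + sqrt (2 * g * h) \<le> V"
    and \<sigma>: "\<sigma> > 0" and cfl: "\<sigma> * V \<le> 1 / 64"
begin

abbreviation "M \<equiv> maxwellian g h v"
abbreviation "L \<equiv> maxwellian g hl v"
abbreviation "R \<equiv> maxwellian g hr v"
abbreviation "Slope \<equiv> entropy_slope g h v z"
abbreviation "Hk f z' \<equiv> (\<lambda>\<xi>. kinetic_entropy g (f \<xi>) \<xi> z')"

definition flux_right :: "real \<Rightarrow> real" where
  "flux_right \<xi> = max \<xi> 0 * R \<xi> + min \<xi> 0 * NR \<xi>"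

definition flux_left :: "real \<Rightarrow> real" where
  "flux_left \<xi> = max \<xi> 0 * NL \<xi> + min \<xi> 0 * L \<xi>"

definition entropy_flux_right :: "real \<Rightarrow> real" where
  "entropy_flux_right \<xi> = max \<xi> 0 * Hk R zr \<xi> + min \<xi> 0 * Hk NR zr \<xi>"

definition entropy_flux_left :: "real \<Rightarrow> real" where
  "entropy_flux_left \<xi> = max \<xi> 0 * Hk NL zl \<xi> + min \<xi> 0 * Hk L zl \<xi>"

definition f_cell :: "real \<Rightarrow> real" where
  "f_cell \<xi> = M \<xi> - \<sigma> * ((flux_right \<xi> + (\<xi> - v) * (M \<xi> - R \<xi>))
                    - (flux_left \<xi> + (\<xi> - v) * (M \<xi> - L \<xi>)))"

lemma reconstructed_heights: "0 \<le> hl" "hl \<le> h" "0 \<le> hr" "hr \<le> h"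
  using recl recr by (auto simp: reconstructed_def)

lemma cont_csupp_maxwellians: "cont_csupp M" "cont_csupp L" "cont_csupp R"
  using g h reconstructed_heights by (auto intro: cont_csupp_maxwellian)

lemma maxwellian_order: "0 \<le> L \<xi>" "L \<xi> \<le> M \<xi>" "0 \<le> R \<xi>" "R \<xi> \<le> M \<xi>" "0 \<le> M \<xi>"
  using g reconstructed_heights by (auto intro: maxwellian_mono maxwellian_nonneg)

lemma support:
  assumes "\<bar>\<xi>\<bar> > V"
  shows "M \<xi> = 0" "L \<xi> = 0" "R \<xi> = 0" "NL \<xi> = 0" "NR \<xi> = 0"
proof -
  show "M \<xi> = 0" using assms V by (intro maxwellian_support g h) auto
  then show "L \<xi> = 0" "R \<xi> = 0" using maxwellian_order[of \<xi>] by auto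
qed (use NL NR assms in auto)

text \<open>
  For each sign of \<open>\<xi>\<close> the update takes the form to which the upwind estimate applies; for
  negative \<open>\<xi>\<close> the two interfaces exchange their roles.
\<close>
lemma f_cell_pos: "0 \<le> \<xi> \<Longrightarrow> f_cell \<xi> = M \<xi> + \<sigma> * \<xi> * (NL \<xi> - L \<xi>) - \<sigma> * v * (R \<xi> - L \<xi>)"
  by (simp add: f_cell_def flux_right_def flux_left_def algebra_simps)

lemma f_cell_neg: "\<xi> \<le> 0 \<Longrightarrow> f_cell \<xi> = M \<xi> + \<sigma> * (- \<xi>) * (NR \<xi> - R \<xi>) - \<sigma> * (- v) * (L \<xi> - R \<xi>)"
  by (simp add: f_cell_def flux_right_def flux_left_def algebra_simps)

lemma V_nonneg: "0 \<le> V" and v_le_V: "\<bar>v\<bar> \<le> V"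
proof -
  have "0 \<le> sqrt (2 * g * h)" using g h by simp
  then show "0 \<le> V" "\<bar>v\<bar> \<le> V" using V by linarith+
qed

lemma scaled_speed_le:
  assumes "\<bar>y\<bar> \<le> V"
  shows "\<bar>\<sigma> * y\<bar> \<le> \<sigma> * V"
  using assms \<sigma> by (simp add: abs_mult)

lemma f_cell_nonneg: "0 \<le> f_cell \<xi>"
proof (cases "\<bar>\<xi>\<bar> > V")
  case True
  then show ?thesis using support[OF True] by (simp add: f_cell_def flux_right_def flux_left_def)
next
  case False
  have key: "0 \<le> m + a * (n - l) - b * (r - l)"
    if "0 \<le> l" "l \<le> m" "0 \<le> r" "r \<le> m" "0 \<le> n" "0 \<le> a" "a \<le> 1 / 64" "\<bar>b\<bar> \<le> 1 / 64"
    for m n l r a b :: real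
  proof -
    have "a * (l - n) \<le> 1 / 64 * m"
      using mult_left_mono[of "l - n" m a] mult_right_mono[of a "1 / 64" m] that by simp
    moreover have "\<bar>b * (r - l)\<bar> \<le> 1 / 64 * m"
      unfolding abs_mult using that by (intro mult_mono) auto
    then have "b * (r - l) \<le> 1 / 64 * m" by linarith
    moreover have "a * (n - l) = - (a * (l - n))" by (simp add: algebra_simps)
    ultimately show ?thesis using that by linarith
  qed
  have a: "\<bar>\<sigma> * \<xi>\<bar> \<le> 1 / 64" and b: "\<bar>\<sigma> * v\<bar> \<le> 1 / 64"
    using scaled_speed_le[of \<xi>] scaled_speed_le[of v] v_le_V False cfl by auto
  show ?thesis
  proof (cases "0 \<le> \<xi>")
    case True
    then have "0 \<le> \<sigma> * \<xi>" using \<sigma> by simp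
    then show ?thesis unfolding f_cell_pos[OF True] using maxwellian_order[of \<xi>] NL(2)[of \<xi>] a b
      by (intro key) auto
  next
    case False
    then have x: "\<xi> \<le> 0" and "0 \<le> \<sigma> * (- \<xi>)" using \<sigma> by (auto simp: mult_nonneg_nonpos)
    then show ?thesis unfolding f_cell_neg[OF x] using maxwellian_order[of \<xi>] NR(2)[of \<xi>] a b
      by (intro key) auto
  qed
qed

lemma pointwise_entropy:
  "Hk f_cell z \<xi> \<le> Hk M z \<xi> - \<sigma> * (entropy_flux_right \<xi> - entropy_flux_left \<xi>)
     + \<sigma> * ((\<xi> * Hk R zr \<xi> - v * Slope \<xi> * R \<xi>) - (\<xi> * Hk L zl \<xi> - v * Slope \<xi> * L \<xi>))
     + 20 * (\<sigma> * V)\<^sup>2 * (g\<^sup>2 * pi\<^sup>2 / 6 * (M \<xi> * (M \<xi> - L \<xi>)\<^sup>2)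
                       + g\<^sup>2 * pi\<^sup>2 / 6 * (M \<xi> * (M \<xi> - R \<xi>)\<^sup>2))"
proof (cases "\<bar>\<xi>\<bar> > V")
  case True
  then show ?thesis using support[OF True]
    by (simp add: f_cell_def flux_right_def flux_left_def entropy_flux_right_def entropy_flux_left_def
        kinetic_entropy_def)
next
  case False
  have a: "\<bar>\<sigma> * \<xi>\<bar> \<le> \<sigma> * V" and b: "\<bar>\<sigma> * v\<bar> \<le> \<sigma> * V"
    using scaled_speed_le[of \<xi>] scaled_speed_le[of v] v_le_V False by auto
  show ?thesis
  proof (cases "0 \<le> \<xi>")
    case True
    then have "0 \<le> \<sigma> * \<xi>" using \<sigma> by simp
    have "Hk f_cell z \<xi> \<le> Hk M z \<xi> + \<sigma> * \<xi> * (Hk NL zl \<xi> - Hk L zl \<xi>)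
      - \<sigma> * v * Slope \<xi> * (R \<xi> - L \<xi>)
      + g\<^sup>2 * pi\<^sup>2 / 6 * (20 * (\<sigma> * V)\<^sup>2 * (M \<xi> * ((M \<xi> - L \<xi>)\<^sup>2 + (M \<xi> - R \<xi>)\<^sup>2)))"
      using a b \<open>0 \<le> \<sigma> * \<xi>\<close> maxwellian_order[of \<xi>]
      by (intro pointwise_upwind_entropy[OF g recl NL(2) _ _ _ _ _ cfl _ _ f_cell_pos[OF True]]) auto
    then show ?thesis
      using True by (simp add: entropy_flux_right_def entropy_flux_left_def algebra_simps)
  next
    case False
    then have x: "\<xi> \<le> 0" and "0 \<le> \<sigma> * (- \<xi>)" using \<sigma> by (auto simp: mult_nonneg_nonpos)
    have "Hk f_cell z \<xi> \<le> Hk M z \<xi> + \<sigma> * (- \<xi>) * (Hk NR zr \<xi> - Hk R zr \<xi>)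
      - \<sigma> * (- v) * Slope \<xi> * (L \<xi> - R \<xi>)
      + g\<^sup>2 * pi\<^sup>2 / 6 * (20 * (\<sigma> * V)\<^sup>2 * (M \<xi> * ((M \<xi> - R \<xi>)\<^sup>2 + (M \<xi> - L \<xi>)\<^sup>2)))"
      using a b \<open>0 \<le> \<sigma> * (- \<xi>)\<close> maxwellian_order[of \<xi>]
      by (intro pointwise_upwind_entropy[OF g recr NR(2) _ _ _ _ _ cfl _ _ f_cell_neg[OF x]]) auto
    then show ?thesis
      using x by (simp add: entropy_flux_right_def entropy_flux_left_def algebra_simps)
  qed
qed

lemma cont_csupp_flux: "cont_csupp flux_right" "cont_csupp flux_left"
  unfolding flux_right_def flux_left_def
  by (intro cont_csupp_intros continuous_intros cont_csupp_maxwellians NL NR)+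

lemma cont_csupp_entropy_flux: "cont_csupp entropy_flux_right" "cont_csupp entropy_flux_left"
  unfolding entropy_flux_right_def entropy_flux_left_def
  by (intro cont_csupp_intros cont_csupp_kinetic_entropy continuous_intros cont_csupp_maxwellians NL NR)+

lemma cont_csupp_f_cell: "cont_csupp f_cell"
  unfolding f_cell_def by (intro cont_csupp_intros continuous_intros cont_csupp_maxwellians cont_csupp_flux)

text \<open>
  The terms \<open>(\<xi> - v) * (M - R)\<close> and \<open>(\<xi> - v) * (M - L)\<close> carry no mass, since all three Maxwellians
  are symmetric about \<open>v\<close>.
\<close>
lemma integral_f_cell: "(LBINT \<xi>. f_cell \<xi>) = h - \<sigma> * ((LBINT \<xi>. flux_right \<xi>) - (LBINT \<xi>. flux_left \<xi>))"
proof -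
  have split: "f_cell \<xi> = (M \<xi> - \<sigma> * (flux_right \<xi> - flux_left \<xi>))
      + \<sigma> * ((\<xi> - v) * R \<xi> - (\<xi> - v) * L \<xi>)" for \<xi>
    by (simp add: f_cell_def algebra_simps)
  have ct: "continuous_on UNIV (\<lambda>\<xi>. \<xi> - v)" by (intro continuous_intros)
  have "(LBINT \<xi>. f_cell \<xi>) = ((LBINT \<xi>. M \<xi>) - \<sigma> * ((LBINT \<xi>. flux_right \<xi>) - (LBINT \<xi>. flux_left \<xi>)))
      + \<sigma> * ((LBINT \<xi>. (\<xi> - v) * R \<xi>) - (LBINT \<xi>. (\<xi> - v) * L \<xi>))"
    unfolding split
    by (simp only: integral_mult_right_zero Bochner_Integration.integral_diff
        Bochner_Integration.integral_add cont_csupp_integrable cont_csupp_intros ct cont_csupp_maxwellians cont_csupp_flux)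
  then show ?thesis
    using maxwellian_mass[OF g h] maxwellian_momentum_centred[OF g] reconstructed_heights by simp
qed

text \<open>
  The reconstructed Maxwellians lie below that of the cell, so the outgoing mass is at most that of the
  cell moving at the maximal speed. This makes the transverse update a convex combination.
\<close>
lemma outflow_bounds:
  "(LBINT \<xi>. flux_right \<xi>) \<le> V * h" "- (LBINT \<xi>. flux_left \<xi>) \<le> V * h"
proof -
  have mass: "(LBINT \<xi>. V * M \<xi>) = V * h" using maxwellian_mass[OF g h] by simp
  have bd: "y * k \<le> V * M \<xi>" if "\<bar>y\<bar> \<le> \<bar>\<xi>\<bar>" "0 \<le> k" "k \<le> M \<xi>" for y k \<xi>
  proof (cases "\<bar>\<xi>\<bar> > V")
    case True
    then show ?thesis using support(1)[OF True] that by simp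
  next
    case False
    then show ?thesis using that V_nonneg by (intro mult_mono) auto
  qed
  have "flux_right \<xi> \<le> V * M \<xi>" for \<xi>
  proof -
    have "max \<xi> 0 * R \<xi> \<le> V * M \<xi>" using maxwellian_order[of \<xi>] by (intro bd) auto
    moreover have "min \<xi> 0 * NR \<xi> \<le> 0" using NR(2)[of \<xi>] by (intro mult_nonpos_nonneg) auto
    ultimately show ?thesis by (simp add: flux_right_def)
  qed
  then have "(LBINT \<xi>. flux_right \<xi>) \<le> (LBINT \<xi>. V * M \<xi>)"
    by (intro integral_mono cont_csupp_integrable cont_csupp_cmult cont_csupp_maxwellians cont_csupp_flux)
  then show "(LBINT \<xi>. flux_right \<xi>) \<le> V * h" by (simp only: mass)
  have "- flux_left \<xi> \<le> V * M \<xi>" for \<xi>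
  proof -
    have "- min \<xi> 0 * L \<xi> \<le> V * M \<xi>" using maxwellian_order[of \<xi>] by (intro bd) auto
    moreover have "0 \<le> max \<xi> 0 * NL \<xi>" using NL(2)[of \<xi>] by (intro mult_nonneg_nonneg) auto
    ultimately show ?thesis by (simp add: flux_left_def)
  qed
  then have "(LBINT \<xi>. - 1 * flux_left \<xi>) \<le> (LBINT \<xi>. V * M \<xi>)"
    by (intro integral_mono cont_csupp_integrable cont_csupp_cmult cont_csupp_maxwellians cont_csupp_flux) auto
  then show "- (LBINT \<xi>. flux_left \<xi>) \<le> V * h" unfolding mass by simp
qed

lemma integral_entropy_f_cell:
  "(LBINT \<xi>. Hk f_cell z \<xi>) \<le> h * v\<^sup>2 / 2 + g * h\<^sup>2 / 2 + g * h * z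
     - \<sigma> * ((LBINT \<xi>. entropy_flux_right \<xi>) - (LBINT \<xi>. entropy_flux_left \<xi>))
     + 5 * (\<sigma> * V)\<^sup>2 * (g * (h - hl)\<^sup>2 + g * (h - hr)\<^sup>2)"
proof -
  define BR BL DR DL where "BR \<xi> = \<xi> * Hk R zr \<xi> - v * Slope \<xi> * R \<xi>"
    and "BL \<xi> = \<xi> * Hk L zl \<xi> - v * Slope \<xi> * L \<xi>"
    and "DR \<xi> = g\<^sup>2 * pi\<^sup>2 / 6 * (M \<xi> * (M \<xi> - R \<xi>)\<^sup>2)"
    and "DL \<xi> = g\<^sup>2 * pi\<^sup>2 / 6 * (M \<xi> * (M \<xi> - L \<xi>)\<^sup>2)" for \<xi>
  have cB: "cont_csupp BR" "cont_csupp BL"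
    unfolding BR_def BL_def entropy_slope_def
    by (intro cont_csupp_diff cont_csupp_mult cont_csupp_kinetic_entropy continuous_intros cont_csupp_maxwellians)+
  have sq: "cont_csupp (\<lambda>\<xi>. g\<^sup>2 * pi\<^sup>2 / 6 * (M \<xi> * (M \<xi> - N \<xi>)\<^sup>2))" if "cont_csupp N" for N
  proof -
    have "cont_csupp (\<lambda>\<xi>. g\<^sup>2 * pi\<^sup>2 / 6 * ((M \<xi> - N \<xi>)\<^sup>2 * M \<xi>))"
      by (intro cont_csupp_cmult cont_csupp_mult cont_csupp_maxwellians continuous_intros cont_csupp_continuous that)
    then show ?thesis by (simp add: mult_ac)
  qed
  have cD: "cont_csupp DR" "cont_csupp DL" unfolding DR_def DL_def by (intro sq cont_csupp_maxwellians)+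
  have "(LBINT \<xi>. Hk f_cell z \<xi>) \<le> (LBINT \<xi>. Hk M z \<xi>
      - \<sigma> * (entropy_flux_right \<xi> - entropy_flux_left \<xi>) + \<sigma> * (BR \<xi> - BL \<xi>)
      + 20 * (\<sigma> * V)\<^sup>2 * (DL \<xi> + DR \<xi>))"
    using pointwise_entropy unfolding BR_def[symmetric] BL_def[symmetric] DR_def[symmetric] DL_def[symmetric]
    by (intro integral_mono cont_csupp_integrable cont_csupp_add cont_csupp_diff cont_csupp_cmult
        cont_csupp_kinetic_entropy cont_csupp_maxwellians cB cD cont_csupp_f_cell cont_csupp_entropy_flux)
  also have "\<dots> = (LBINT \<xi>. Hk M z \<xi>)
      - \<sigma> * ((LBINT \<xi>. entropy_flux_right \<xi>) - (LBINT \<xi>. entropy_flux_left \<xi>))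
      + \<sigma> * ((LBINT \<xi>. BR \<xi>) - (LBINT \<xi>. BL \<xi>))
      + 20 * (\<sigma> * V)\<^sup>2 * ((LBINT \<xi>. DL \<xi>) + (LBINT \<xi>. DR \<xi>))"
    by (simp only: integral_mult_right_zero Bochner_Integration.integral_diff
        Bochner_Integration.integral_add cont_csupp_integrable cont_csupp_add cont_csupp_diff
        cont_csupp_cmult cont_csupp_kinetic_entropy cont_csupp_maxwellians cB cD cont_csupp_entropy_flux)
  also have "(LBINT \<xi>. BR \<xi>) = 0"
    unfolding BR_def using recr
    by (intro integral_entropy_flux_balance g reconstructed_heights) (auto simp: reconstructed_def)
  also have "(LBINT \<xi>. BL \<xi>) = 0"
    unfolding BL_def using recl
    by (intro integral_entropy_flux_balance g reconstructed_heights) (auto simp: reconstructed_def)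
  also have "(LBINT \<xi>. Hk M z \<xi>) = h * v\<^sup>2 / 2 + g * h\<^sup>2 / 2 + g * h * z"
    by (rule integral_kinetic_entropy_maxwellian[OF g h])
  finally have main: "(LBINT \<xi>. Hk f_cell z \<xi>) \<le> h * v\<^sup>2 / 2 + g * h\<^sup>2 / 2 + g * h * z
     - \<sigma> * ((LBINT \<xi>. entropy_flux_right \<xi>) - (LBINT \<xi>. entropy_flux_left \<xi>))
     + 20 * (\<sigma> * V)\<^sup>2 * ((LBINT \<xi>. DL \<xi>) + (LBINT \<xi>. DR \<xi>))" by simp
  \<comment> \<open>The factor 20 of the remainder and the factor 1 / 4 of the distance give the constant 5.\<close>
  have "(LBINT \<xi>. DL \<xi>) + (LBINT \<xi>. DR \<xi>) \<le> g / 4 * (h - hl)\<^sup>2 + g / 4 * (h - hr)\<^sup>2"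
    unfolding DL_def DR_def by (intro add_mono integral_maxwellian_distance g reconstructed_heights)
  then have "20 * (\<sigma> * V)\<^sup>2 * ((LBINT \<xi>. DL \<xi>) + (LBINT \<xi>. DR \<xi>))
      \<le> 20 * (\<sigma> * V)\<^sup>2 * (g / 4 * (h - hl)\<^sup>2 + g / 4 * (h - hr)\<^sup>2)"
    by (intro mult_left_mono) auto
  also have "\<dots> = 5 * (\<sigma> * V)\<^sup>2 * (g * (h - hl)\<^sup>2 + g * (h - hr)\<^sup>2)"
    by (simp add: algebra_simps)
  finally show ?thesis using main by linarith
qed

lemma hydrostatic_entropy:
  defines "h' \<equiv> (LBINT \<xi>. f_cell \<xi>)" and "p' \<equiv> (LBINT \<xi>. \<xi> * f_cell \<xi>)"
  shows "h' / 2 * (p' / h')\<^sup>2 + g / 2 * h'\<^sup>2 + g * h' * z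
     \<le> h * v\<^sup>2 / 2 + g * h\<^sup>2 / 2 + g * h * z
     - \<sigma> * ((LBINT \<xi>. entropy_flux_right \<xi>) - (LBINT \<xi>. entropy_flux_left \<xi>))
     + 5 * (\<sigma> * V)\<^sup>2 * (g * (h - hl)\<^sup>2 + g * (h - hr)\<^sup>2)"
  unfolding h'_def p'_def
  by (rule order_trans[OF maxwellian_minimises_entropy[OF g cont_csupp_f_cell f_cell_nonneg refl refl]
        integral_entropy_f_cell])

text \<open>
  Upwinding writes the new transverse momentum as a combination of the three neighbouring transverse
  velocities whose nonnegative weights \<open>a\<close>, \<open>b\<close>, \<open>c\<close> add up to the new depth, so the claim is the
  convexity of the square. A dry new state has all weights zero.
\<close>
lemma transverse_entropy:
  fixes w wl wr :: real
  defines "FR \<equiv> (LBINT \<xi>. flux_right \<xi>)" and "FL \<equiv> (LBINT \<xi>. flux_left \<xi>)"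
    and "h' \<equiv> (LBINT \<xi>. f_cell \<xi>)"
  defines "wR \<equiv> (if FR \<ge> 0 then w else wr)" and "wL \<equiv> (if FL \<ge> 0 then wl else w)"
  shows "h' / 2 * ((h * w - \<sigma> * (wR * FR - wL * FL)) / h')\<^sup>2
     \<le> h * w\<^sup>2 / 2 - \<sigma> * (FR * (wR\<^sup>2 / 2) - FL * (wL\<^sup>2 / 2))"
proof -
  define a b c where "a = h - \<sigma> * max FR 0 - \<sigma> * max (- FL) 0"
    and "b = \<sigma> * max (- FR) 0" and "c = \<sigma> * max FL 0"
  have Vh: "0 \<le> V * h" using V_nonneg h by simp
  have "max FR 0 \<le> V * h" "max (- FL) 0 \<le> V * h"
    using outflow_bounds Vh by (auto simp: FR_def FL_def)
  then have "\<sigma> * max FR 0 \<le> \<sigma> * (V * h)" "\<sigma> * max (- FL) 0 \<le> \<sigma> * (V * h)"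
    using \<sigma> by (intro mult_left_mono; simp)+
  moreover have "\<sigma> * (V * h) \<le> 1 / 64 * h"
    using mult_right_mono[OF cfl h] by (simp add: mult.assoc)
  ultimately have a: "a \<ge> 0" using h by (simp add: a_def)
  have bc: "b \<ge> 0" "c \<ge> 0" using \<sigma> by (simp_all add: b_def c_def)
  have h': "h' = a + b + c"
    unfolding h'_def integral_f_cell FR_def[symmetric] FL_def[symmetric] a_def b_def c_def
    by (simp add: max_def algebra_simps)
  have num: "h * w - \<sigma> * (wR * FR - wL * FL) = a * w + b * wr + c * wl"
    by (simp add: wR_def wL_def a_def b_def c_def max_def algebra_simps)
  have rhs: "h * w\<^sup>2 / 2 - \<sigma> * (FR * (wR\<^sup>2 / 2) - FL * (wL\<^sup>2 / 2))
      = (a * w\<^sup>2 + b * wr\<^sup>2 + c * wl\<^sup>2) / 2"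
    by (simp add: wR_def wL_def a_def b_def c_def max_def field_simps)
  show ?thesis
    using weighted_mean_square[OF a bc, of w wr wl] unfolding num rhs h' by simp
qed

end

section \<open>The prediction step on the mesh\<close>

lemma max_indicator: "max \<xi> 0 = \<xi> * indicator {0<..} \<xi>"
  and min_indicator: "min \<xi> 0 = \<xi> * indicator {..<0} \<xi>" for \<xi> :: real
  by (auto simp: indicator_def)

lemma set_integral_signed_halves:
  assumes "cont_csupp \<phi>" "cont_csupp \<psi>"
  shows "(LBINT \<xi>:{..<0}. \<xi> * \<phi> \<xi>) + (LBINT \<xi>:{0<..}. \<xi> * \<psi> \<xi>)
      = (LBINT \<xi>. max \<xi> 0 * \<psi> \<xi> + min \<xi> 0 * \<phi> \<xi>)"
proof -
  have "(LBINT \<xi>. max \<xi> 0 * \<psi> \<xi> + min \<xi> 0 * \<phi> \<xi>)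
      = (LBINT \<xi>. max \<xi> 0 * \<psi> \<xi>) + (LBINT \<xi>. min \<xi> 0 * \<phi> \<xi>)"
    by (intro Bochner_Integration.integral_add cont_csupp_integrable cont_csupp_mult assms
        continuous_intros)
  then show ?thesis
    by (simp add: set_lebesgue_integral_def max_indicator min_indicator mult_ac)
qed

lemma entropy_split:
  "entropy g z (h, p, q) = (h / 2 * (p / h)\<^sup>2 + g / 2 * h\<^sup>2 + g * h * z) + h / 2 * (q / h)\<^sup>2"
  by (simp add: entropy_def algebra_simps)

text \<open>
  A dry state has velocity quotient \<open>0\<close> instead of \<open>u i\<close>, but its kinetic energy is \<open>0\<close> either way.
\<close>
lemma entropy_state:
  "entropy g z (state H u w i)
    = (H i * (u i)\<^sup>2 / 2 + g * (H i)\<^sup>2 / 2 + g * H i * z) + H i * (w i)\<^sup>2 / 2"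
  by (cases "H i = 0") (simp_all add: entropy_def state_def algebra_simps)

lemma H_minus_nonneg: "0 \<le> H_minus H zb i" and H_plus_nonneg: "0 \<le> H_plus H zb i"
  by (simp_all add: H_minus_def H_plus_def)

lemma H_minus_le: "0 \<le> H i \<Longrightarrow> H_minus H zb i \<le> H i"
  and H_plus_le: "0 \<le> H (i + 1) \<Longrightarrow> H_plus H zb i \<le> H (i + 1)"
  by (simp_all add: H_minus_def H_plus_def z_half_def)

text \<open>
  Either the depth is lowered by exactly the rise of the bottom, or all of it is lost and the rise
  exceeds it.
\<close>
lemma H_minus_loss:
  assumes "0 \<le> H i"
  shows "(H i - H_minus H zb i)\<^sup>2 \<le> (zb (i + 1) - zb i)\<^sup>2"
  unfolding abs_le_square_iff[symmetric] using assms
  by (auto simp: H_minus_def z_half_def max_def abs_if)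

lemma H_plus_loss:
  assumes "0 \<le> H (i + 1)"
  shows "(H (i + 1) - H_plus H zb i)\<^sup>2 \<le> (zb (i + 1) - zb i)\<^sup>2"
  unfolding abs_le_square_iff[symmetric] using assms
  by (auto simp: H_plus_def z_half_def max_def abs_if)

theorem proposition5p1:
  fixes g B :: real
  assumes "g > 0"
  shows "\<exists>v\<^sub>m > 0. \<exists>C\<^sub>\<beta> \<ge> 0. \<exists>\<sigma>\<^sub>0 > 0.
    \<forall>(H :: int \<Rightarrow> real) (u :: int \<Rightarrow> real) (w :: int \<Rightarrow> real) (zb :: int \<Rightarrow> real)
      (dx :: int \<Rightarrow> real) (dt :: real) (i :: int).
      (\<forall>j. H j \<ge> 0) \<longrightarrow>
      (\<forall>j \<in> {i - 1, i, i + 1}. H j \<le> B \<and> \<bar>u j\<bar> \<le> B) \<longrightarrow>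
      (\<forall>j. dx j > 0) \<longrightarrow> dt > 0 \<longrightarrow> cell_ratio dt dx i \<le> \<sigma>\<^sub>0 \<longrightarrow>
        entropy g (zb i) (predicted_state g (cell_ratio dt dx i) H u w zb i)
        \<le> entropy g (zb i) (state H u w i)
          - cell_ratio dt dx i * (G_tilde g H u w zb i - G_tilde g H u w zb (i - 1))
          + C\<^sub>\<beta> * (cell_ratio dt dx i * v\<^sub>m)\<^sup>2
              * (g * (zb (i + 1) - zb i)\<^sup>2 + g * (zb i - zb (i - 1))\<^sup>2)"
proof -
  note g = assms
  \<comment> \<open>A bound for the speeds at which the three Maxwellians carry mass; the summand 1 keeps it positive.\<close>
  define V where "V = \<bar>B\<bar> + sqrt (2 * g * \<bar>B\<bar>) + 1"
  have "0 \<le> sqrt (2 * g * \<bar>B\<bar>)" using g by simp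
  then have Vpos: "V > 0" unfolding V_def by linarith
  have "entropy g (zb i) (predicted_state g (cell_ratio dt dx i) H u w zb i)
        \<le> entropy g (zb i) (state H u w i)
          - cell_ratio dt dx i * (G_tilde g H u w zb i - G_tilde g H u w zb (i - 1))
          + 5 * (cell_ratio dt dx i * V)\<^sup>2
              * (g * (zb (i + 1) - zb i)\<^sup>2 + g * (zb i - zb (i - 1))\<^sup>2)"
    if H0: "\<forall>j. H j \<ge> 0" and bd: "\<forall>j \<in> {i - 1, i, i + 1}. H j \<le> B \<and> \<bar>u j\<bar> \<le> B"
      and dx: "\<forall>j. dx j > 0" and dt: "dt > 0" and small: "cell_ratio dt dx i \<le> 1 / (64 * V)"
    for H u w zb dx :: "int \<Rightarrow> real" and dt :: real and i :: int
  proof -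
    define \<sigma> where "\<sigma> = cell_ratio dt dx i"
    have \<sigma>: "\<sigma> > 0" using dx dt by (simp add: \<sigma>_def cell_ratio_def)
    have cfl: "\<sigma> * V \<le> 1 / 64"
      using mult_right_mono[OF small, of V] Vpos by (simp add: \<sigma>_def)
    have speed: "\<bar>u j\<bar> + sqrt (2 * g * k) \<le> V" if "j \<in> {i - 1, i, i + 1}" "k \<le> H j" for j k
    proof -
      have "k \<le> \<bar>B\<bar>" "\<bar>u j\<bar> \<le> \<bar>B\<bar>" using bd that by force+
      then have "sqrt (2 * g * k) \<le> sqrt (2 * g * \<bar>B\<bar>)" using g by simp
      then show ?thesis using \<open>\<bar>u j\<bar> \<le> \<bar>B\<bar>\<close> unfolding V_def by linarith
    qed
    have Mm: "M_minus g H u zb j = maxwellian g (H_minus H zb j) (u j)"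
      and Mp: "M_plus g H u zb j = maxwellian g (H_plus H zb j) (u (j + 1))"
      and Mc: "M_cell g H u j = maxwellian g (H j) (u j)" for j
      by (simp_all add: fun_eq_iff M_minus_def M_plus_def M_cell_def)
    interpret kinetic_cell g "H i" "u i" "zb i" "H_plus H zb (i - 1)" "z_half zb (i - 1)"
      "H_minus H zb i" "z_half zb i" \<sigma> V "M_minus g H u zb (i - 1)" "M_plus g H u zb i"
    proof
      show "reconstructed (H i) (zb i) (H_plus H zb (i - 1)) (z_half zb (i - 1))"
        using reconstructed_max[of "H i" "zb i" "z_half zb (i - 1)"] H0
        by (simp add: H_plus_def z_half_def)
      show "reconstructed (H i) (zb i) (H_minus H zb i) (z_half zb i)"
        using reconstructed_max[of "H i" "zb i" "z_half zb i"] H0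
        by (simp add: H_minus_def z_half_def)
      show "cont_csupp (M_minus g H u zb (i - 1))" "cont_csupp (M_plus g H u zb i)"
        unfolding Mm Mp by (intro cont_csupp_maxwellian g H_minus_nonneg H_plus_nonneg)+
      show "0 \<le> M_minus g H u zb (i - 1) \<xi>" "0 \<le> M_plus g H u zb i \<xi>" for \<xi>
        unfolding Mm Mp using g by (auto intro: maxwellian_nonneg)
      show "M_minus g H u zb (i - 1) \<xi> = 0" if "\<bar>\<xi>\<bar> > V" for \<xi>
        unfolding Mm
        using that speed[of "i - 1" "H_minus H zb (i - 1)"] H_minus_le[of H "i - 1" zb] H0
        by (intro maxwellian_support g H_minus_nonneg) auto
      show "M_plus g H u zb i \<xi> = 0" if "\<bar>\<xi>\<bar> > V" for \<xi>
        unfolding Mp using that speed[of "i + 1" "H_plus H zb i"] H_plus_le[of H i zb] H0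
        by (intro maxwellian_support g H_plus_nonneg) auto
    qed (use g H0 \<sigma> cfl speed[of i "H i"] in auto)
    have f_cell_eq: "f_cell = f_pred g \<sigma> H u zb i"
      unfolding fun_eq_iff f_cell_def f_pred_def flux_right_def flux_left_def dM_minus_def dM_plus_def
      by (simp add: Mm Mp Mc max_indicator min_indicator algebra_simps)
    have FR: "(LBINT \<xi>. flux_right \<xi>) = F_H g H u zb i"
      and FL: "(LBINT \<xi>. flux_left \<xi>) = F_H g H u zb (i - 1)"
      unfolding F_H_def flux_right_def flux_left_def
      by (simp_all add: Mm Mp max_indicator min_indicator algebra_simps)
    have GR: "(LBINT \<xi>. entropy_flux_right \<xi>) = G_hyd g H u zb i"
      unfolding G_hyd_def entropy_flux_right_def Mm
      by (intro set_integral_signed_halves[symmetric] cont_csupp_kinetic_entropy cont_csupp_maxwellians NR)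
    have GL: "(LBINT \<xi>. entropy_flux_left \<xi>) = G_hyd g H u zb (i - 1)"
    proof -
      have "M_plus g H u zb (i - 1) = maxwellian g (H_plus H zb (i - 1)) (u i)" by (simp add: Mp)
      then show ?thesis
        unfolding G_hyd_def entropy_flux_left_def
        by (simp only:) (intro set_integral_signed_halves[symmetric] cont_csupp_kinetic_entropy cont_csupp_maxwellians NL)
    qed
    have w: "w_half g H u w zb i = (if F_H g H u zb i \<ge> 0 then w i else w (i + 1))"
      "w_half g H u w zb (i - 1) = (if F_H g H u zb (i - 1) \<ge> 0 then w (i - 1) else w i)"
      by (simp_all add: w_half_def)
    have "5 * (\<sigma> * V)\<^sup>2 * (g * (H i - H_plus H zb (i - 1))\<^sup>2 + g * (H i - H_minus H zb i)\<^sup>2)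
        \<le> 5 * (\<sigma> * V)\<^sup>2 * (g * (zb i - zb (i - 1))\<^sup>2 + g * (zb (i + 1) - zb i)\<^sup>2)"
      using H_plus_loss[of H "i - 1" zb] H_minus_loss[of H i zb] H0 g
      by (intro mult_left_mono add_mono) auto
    with hydrostatic_entropy transverse_entropy[of "w i" "w (i + 1)" "w (i - 1)"]
    show ?thesis
      unfolding predicted_state_def entropy_split entropy_state \<sigma>_def[symmetric] G_tilde_def
        f_cell_eq FR FL GR GL w[symmetric]
      by (simp add: algebra_simps)
  qed
  then show ?thesis
    using Vpos by (intro exI[of _ V] conjI exI[of _ "5 :: real"] exI[of _ "1 / (64 * V)"]) auto
qed

end
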